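(* Consider the DAG tracing problem on an input $(x, G=(V,E), r, f)$ in the Asymmetric NP model, and let $D(G)$ be the length of the longest path in $G$, $R(G,x)=\{v\in V : f(x,v)\text{ is true}\}$ the set of visible vertices, and $S(G,x)=\{v\in V : f(x,v)\text{ is true and } v \text{ has out-degree } 0\}$ the output set. Suppose that the problem has the traceable property, that every vertex of $G$ has constant degree, that $f(x,v)$ can be evaluated in constant time, and that the small symmetric memory has size $O(D(G))$. Then the DAG tracing problem can be solved with $O(|R(G,x)|)$ work, $O(D(G))$ depth, and $O(|S(G,x)|)$ writes to the large memory.
   Context: DAG tracing problem: given an element $x$, a directed acyclic graph $G=(V,E)$ (explicitly stored in memory), a root vertex $r\in V$ of in-degree zero, and a Boolean predicate $f(x,v)$, compute the set $S(G,x)=\{v\in V : f(x,v)\text{ holds and } v \text{ has out-degree } 0\}$. A vertex $v$ is called visible if $f(x,v)$ holds. The problem has the traceable property if every visible vertex $v\in V$ has at least one direct predecessor $u$ (i.e. $(u,v)\in E$) that is visible. Asymmetric Nested-Parallel (NP) model: a computation is a series-parallel DAG produced by tasks that can fork two child tasks and wait for them to finish (binary fork-join). There is an unbounded large asymmetric memory shared by all processors, in which each write costs $\omega\ge 1$, and each task has a small private symmetric memory; all other operations (including reads and accesses to the small memory) cost $1$. Work is the total cost of all operations; depth is the number of operations on the longest (unweighted) path of the computation DAG. "Writes" refers to writes to the large memory only.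
   Formalization: The root is exempt from the traceable property (else R is empty); as outputs must be written at cost ω, work is bounded by O(|R|+1+ω|S|), and by O(ω(|R|+1)), uniformly in ω; the depth and small-memory bounds use D(G)+1 in place of D(G). *)

theory Defs
  imports Complex_Main
begin

subsection \<open>DAG tracing\<close>

definition rooted_dag :: "'v set \<Rightarrow> ('v \<times> 'v) set \<Rightarrow> 'v \<Rightarrow> bool" where
  "rooted_dag V E r \<longleftrightarrow>
     finite V \<and> E \<subseteq> V \<times> V \<and> acyclic E \<and> r \<in> V \<and> card (E\<inverse> `` {r}) = 0"

definition visible_set :: "'v set \<Rightarrow> ('x \<Rightarrow> 'v \<Rightarrow> bool) \<Rightarrow> 'x \<Rightarrow> 'v set" where
  "visible_set V f x = {v \<in> V. f x v}"

definition output_set :: "'v set \<Rightarrow> ('v \<times> 'v) set \<Rightarrow> ('x \<Rightarrow> 'v \<Rightarrow> bool) \<Rightarrow> 'x \<Rightarrow> 'v set" where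
  "output_set V E f x = {v \<in> V. f x v \<and> card (E `` {v}) = 0}"

text \<open>The root has no predecessor at all, so the condition can only be meant for the
  other vertices: imposed on the root as well, it would force every vertex of a finite DAG
  to be invisible.\<close>

definition traceable ::
  "'v set \<Rightarrow> ('v \<times> 'v) set \<Rightarrow> 'v \<Rightarrow> ('x \<Rightarrow> 'v \<Rightarrow> bool) \<Rightarrow> 'x \<Rightarrow> bool" where
  "traceable V E r f x \<longleftrightarrow> (\<forall>v\<in>V - {r}. f x v \<longrightarrow> (\<exists>u\<in>V. (u, v) \<in> E \<and> f x u))"

text \<open>The length of a path is its number of edges. In a DAG every walk is a path.\<close>

definition longest_path :: "'v set \<Rightarrow> ('v \<times> 'v) set \<Rightarrow> nat" where
  "longest_path V E = Max {k. \<exists>u\<in>V. \<exists>v\<in>V. (u, v) \<in> E ^^ k}"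

definition degree_le :: "nat \<Rightarrow> 'v set \<Rightarrow> ('v \<times> 'v) set \<Rightarrow> bool" where
  "degree_le d V E \<longleftrightarrow> (\<forall>v\<in>V. card (E `` {v}) + card (E\<inverse> `` {v}) \<le> d)"


subsection \<open>Computation DAGs and their costs\<close>

text \<open>A series-parallel computation DAG. \<open>Ops k\<close> is a chain of \<open>k\<close> operations that do not touch
  the large memory; \<open>Rd a\<close> and \<open>Wr a\<close> are single accesses to cell \<open>a\<close> of the large memory.
  Depth is unweighted: a write counts once, whatever \<open>\<omega>\<close> is.\<close>

datatype comp = Ops nat | Rd nat | Wr nat | Ser comp comp | Par comp comp

primrec work :: "real \<Rightarrow> comp \<Rightarrow> real" where
  "work \<omega> (Ops k) = real k"
| "work \<omega> (Rd a) = 1"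
| "work \<omega> (Wr a) = \<omega>"
| "work \<omega> (Ser s t) = work \<omega> s + work \<omega> t"
| "work \<omega> (Par s t) = work \<omega> s + work \<omega> t"

primrec depth :: "comp \<Rightarrow> nat" where
  "depth (Ops k) = k"
| "depth (Rd a) = 1"
| "depth (Wr a) = 1"
| "depth (Ser s t) = depth s + depth t"
| "depth (Par s t) = max (depth s) (depth t)"

primrec num_writes :: "comp \<Rightarrow> nat" where
  "num_writes (Ops k) = 0"
| "num_writes (Rd a) = 0"
| "num_writes (Wr a) = 1"
| "num_writes (Ser s t) = num_writes s + num_writes t"
| "num_writes (Par s t) = num_writes s + num_writes t"

primrec read_cells :: "comp \<Rightarrow> nat set" where
  "read_cells (Ops k) = {}"
| "read_cells (Rd a) = {a}"
| "read_cells (Wr a) = {}"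
| "read_cells (Ser s t) = read_cells s \<union> read_cells t"
| "read_cells (Par s t) = read_cells s \<union> read_cells t"

primrec written_cells :: "comp \<Rightarrow> nat set" where
  "written_cells (Ops k) = {}"
| "written_cells (Rd a) = {}"
| "written_cells (Wr a) = {a}"
| "written_cells (Ser s t) = written_cells s \<union> written_cells t"
| "written_cells (Par s t) = written_cells s \<union> written_cells t"

definition race_free :: "comp \<Rightarrow> comp \<Rightarrow> bool" where
  "race_free s t \<longleftrightarrow>
     written_cells s \<inter> (read_cells t \<union> written_cells t) = {} \<and>
     written_cells t \<inter> read_cells s = {}"


subsection \<open>The Asymmetric NP model\<close>

text \<open>Memories are addressed by natural numbers. A task may only use the cells below
  \<open>small_size\<close> of its small memory, and all words it handles are below \<open>word_bound\<close>.
  The predicate \<open>v \<mapsto> f x v\<close> is a black box that costs \<open>pred_cost v\<close> operations and does not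
  write to the large memory.\<close>

type_synonym mem = "nat \<Rightarrow> nat"

record machine =
  small_size :: nat
  word_bound :: nat
  vis_pred :: "nat \<Rightarrow> bool"
  pred_cost :: "nat \<Rightarrow> nat"

text \<open>Expressions over the small memory. \<open>Cell (Num k)\<close> is the word in cell \<open>k\<close>; nesting \<open>Cell\<close>
  gives indirect addressing. Comparisons return 0 or 1, and subtraction is truncated.\<close>

datatype expr =
  Num nat | Cell expr | Add expr expr | Sub expr expr | Less expr expr | Equal expr expr

primrec eval :: "mem \<Rightarrow> expr \<Rightarrow> nat" where
  "eval m (Num k) = k"
| "eval m (Cell e) = m (eval m e)"
| "eval m (Add d e) = eval m d + eval m e"
| "eval m (Sub d e) = eval m d - eval m e"
| "eval m (Less d e) = of_bool (eval m d < eval m e)"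
| "eval m (Equal d e) = of_bool (eval m d = eval m e)"

primrec legal :: "machine \<Rightarrow> mem \<Rightarrow> expr \<Rightarrow> bool" where
  "legal C m (Num k) \<longleftrightarrow> k < word_bound C"
| "legal C m (Cell e) \<longleftrightarrow>
     legal C m e \<and> eval m e < small_size C \<and> m (eval m e) < word_bound C"
| "legal C m (Add d e) \<longleftrightarrow> legal C m d \<and> legal C m e \<and> eval m d + eval m e < word_bound C"
| "legal C m (Sub d e) \<longleftrightarrow> legal C m d \<and> legal C m e"
| "legal C m (Less d e) \<longleftrightarrow> legal C m d \<and> legal C m e"
| "legal C m (Equal d e) \<longleftrightarrow> legal C m d \<and> legal C m e"

primrec ops :: "expr \<Rightarrow> nat" where
  "ops (Num k) = 1"
| "ops (Cell e) = ops e + 1"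
| "ops (Add d e) = ops d + ops e + 1"
| "ops (Sub d e) = ops d + ops e + 1"
| "ops (Less d e) = ops d + ops e + 1"
| "ops (Equal d e) = ops d + ops e + 1"

text \<open>In \<open>Assign a e\<close>, \<open>Load a e\<close> and \<open>Eval_Pred a e\<close> the expression \<open>a\<close> is the address of the
  target cell in the small memory; \<open>Load a e\<close> reads the large memory at \<open>e\<close>, and \<open>Store a e\<close>
  writes \<open>e\<close> to the large memory at \<open>a\<close>. \<open>Fork p as rs q bs ss\<close> starts procedures \<open>p\<close> and \<open>q\<close> as
  child tasks on the argument words \<open>as\<close> and \<open>bs\<close>. When both have finished, the first
  words of their small memories are copied to the parent's cells \<open>rs\<close> and \<open>ss\<close>.\<close>

datatype com =
    Skip
  | Assign expr expr
  | Load expr expr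
  | Store expr expr
  | Eval_Pred expr expr
  | Seq com com
  | If_Nonzero expr com com
  | While_Nonzero expr com
  | Fork nat "expr list" "nat list" nat "expr list" "nat list"

text \<open>The private small memory of a new task: its arguments, and zeros elsewhere.\<close>

definition frame :: "nat list \<Rightarrow> mem" where
  "frame ws = (\<lambda>i. if i < length ws then ws ! i else 0)"

fun receive :: "nat list \<Rightarrow> nat \<Rightarrow> mem \<Rightarrow> mem \<Rightarrow> mem" where
  "receive [] i mc m = m"
| "receive (r # rs) i mc m = receive rs (Suc i) mc (m(r := mc i))"

text \<open>\<open>exec C P c (m, h) t (m', h')\<close>: a task running \<open>c\<close> with small memory \<open>m\<close> and large memory
  \<open>h\<close> terminates in \<open>m'\<close> and \<open>h'\<close>, and produces the computation DAG \<open>t\<close>. A program is a finite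
  list of procedures. An illegal access or expression has no execution.

  Parallel tasks may read the same cell of the large memory, but a cell written by one of two
  parallel tasks must not be accessed by the other. Hence neither child can
  observe the other, and the outcome of a fork does not depend on the scheduling.\<close>

inductive exec ::
    "machine \<Rightarrow> com list \<Rightarrow> com \<Rightarrow> mem \<times> mem \<Rightarrow> comp \<Rightarrow> mem \<times> mem \<Rightarrow> bool"
  for C P where
  exec_Skip: "exec C P Skip (m, h) (Ops 1) (m, h)"
| exec_Assign:
    "\<lbrakk>legal C m a; legal C m e; eval m a < small_size C\<rbrakk> \<Longrightarrow>
     exec C P (Assign a e) (m, h) (Ops (ops a + ops e + 1)) (m(eval m a := eval m e), h)"
| exec_Load:
    "\<lbrakk>legal C m a; legal C m e; eval m a < small_size C; h (eval m e) < word_bound C\<rbrakk> \<Longrightarrow>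
     exec C P (Load a e) (m, h)
       (Ser (Ops (ops a + ops e)) (Rd (eval m e))) (m(eval m a := h (eval m e)), h)"
| exec_Store:
    "\<lbrakk>legal C m a; legal C m e\<rbrakk> \<Longrightarrow>
     exec C P (Store a e) (m, h)
       (Ser (Ops (ops a + ops e)) (Wr (eval m a))) (m, h(eval m a := eval m e))"
| exec_Eval_Pred:
    "\<lbrakk>legal C m a; legal C m e; eval m a < small_size C\<rbrakk> \<Longrightarrow>
     exec C P (Eval_Pred a e) (m, h)
       (Ops (ops a + ops e + 1 + pred_cost C (eval m e)))
       (m(eval m a := of_bool (vis_pred C (eval m e))), h)"
| exec_Seq:
    "\<lbrakk>exec C P c (m, h) s (m', h'); exec C P d (m', h') t (m'', h'')\<rbrakk> \<Longrightarrow>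
     exec C P (Seq c d) (m, h) (Ser s t) (m'', h'')"
| exec_If_True:
    "\<lbrakk>legal C m e; eval m e \<noteq> 0; exec C P c (m, h) t (m', h')\<rbrakk> \<Longrightarrow>
     exec C P (If_Nonzero e c d) (m, h) (Ser (Ops (ops e + 1)) t) (m', h')"
| exec_If_False:
    "\<lbrakk>legal C m e; eval m e = 0; exec C P d (m, h) t (m', h')\<rbrakk> \<Longrightarrow>
     exec C P (If_Nonzero e c d) (m, h) (Ser (Ops (ops e + 1)) t) (m', h')"
| exec_While_False:
    "\<lbrakk>legal C m e; eval m e = 0\<rbrakk> \<Longrightarrow>
     exec C P (While_Nonzero e c) (m, h) (Ops (ops e + 1)) (m, h)"
| exec_While_True:
    "\<lbrakk>legal C m e; eval m e \<noteq> 0; exec C P c (m, h) s (m', h');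
      exec C P (While_Nonzero e c) (m', h') t (m'', h'')\<rbrakk> \<Longrightarrow>
     exec C P (While_Nonzero e c) (m, h) (Ser (Ops (ops e + 1)) (Ser s t)) (m'', h'')"
| exec_Fork:
    "\<lbrakk>p < length P; q < length P;
      \<forall>e\<in>set as \<union> set bs. legal C m e;
      length as \<le> small_size C; length bs \<le> small_size C;
      length rs \<le> small_size C; length ss \<le> small_size C;
      \<forall>r\<in>set rs \<union> set ss. r < small_size C;
      exec C P (P ! p) (frame (map (eval m) as), h) s (m1, h1);
      exec C P (P ! q) (frame (map (eval m) bs), h) t (m2, h2);
      race_free s t\<rbrakk> \<Longrightarrow>
     exec C P (Fork p as rs q bs ss) (m, h)
       (Ser (Ops (sum_list (map ops (as @ bs)) + length (as @ bs) + 1))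
         (Ser (Par s t) (Ops (length (rs @ ss) + 1))))
       (receive ss 0 m2 (receive rs 0 m1 m), override_on h1 h2 (written_cells t))"

text \<open>A run is the execution of procedure 0 on the given input words.\<close>

definition run ::
  "machine \<Rightarrow> com list \<Rightarrow> nat list \<Rightarrow> mem \<Rightarrow> comp \<Rightarrow> mem \<Rightarrow> mem \<Rightarrow> bool" where
  "run C P ws h t m' h' \<longleftrightarrow>
     P \<noteq> [] \<and> length ws \<le> small_size C \<and> (\<forall>w\<in>set ws. w < word_bound C) \<and>
     exec C P (P ! 0) (frame ws, h) t (m', h')"

text \<open>Executions are deterministic, so the existence of a run with some property says that
  the run of the program has this property.\<close>

lemma exec_deterministic:
  assumes "exec C P c st t st'" and "exec C P c st u st''"
  shows "u = t \<and> st'' = st'"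
  using assms
proof (induction arbitrary: u st'' rule: exec.induct)
  case exec_Seq from exec_Seq.prems show ?case by (cases rule: exec.cases) (use exec_Seq.IH in blast)+
next
  case exec_If_True from exec_If_True.prems show ?case by (cases rule: exec.cases) (use exec_If_True in blast)+
next
  case exec_If_False from exec_If_False.prems show ?case by (cases rule: exec.cases) (use exec_If_False in blast)+
next
  case exec_While_True from exec_While_True.prems show ?case by (cases rule: exec.cases) (use exec_While_True in blast)+
next
  case exec_While_False from exec_While_False.prems show ?case by (cases rule: exec.cases) (use exec_While_False in blast)+
next
  case exec_Fork from exec_Fork.prems show ?case by (cases rule: exec.cases) (use exec_Fork.IH in blast)+
qed (erule exec.cases; simp)+

subsection \<open>Input and output in the large memory\<close>

definition stores_list :: "mem \<Rightarrow> nat \<Rightarrow> nat \<Rightarrow> nat list \<Rightarrow> bool" where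
  "stores_list h free p xs \<longleftrightarrow>
     p + length xs < free \<and> h p = length xs \<and> (\<forall>i<length xs. h (p + 1 + i) = xs ! i)"

text \<open>The graph on the vertices \<open>{..<n}\<close> lies below address \<open>free\<close>: the tables at \<open>succs\<close> and
  \<open>preds\<close> contain, for each vertex, a pointer to the list of its direct successors and
  predecessors. The contents of the cells from \<open>free\<close> on are arbitrary.\<close>

definition stores_graph ::
  "mem \<Rightarrow> nat \<Rightarrow> (nat \<times> nat) set \<Rightarrow> nat \<Rightarrow> nat \<Rightarrow> nat \<Rightarrow> bool" where
  "stores_graph h n E succs preds free \<longleftrightarrow>
     succs + n \<le> free \<and> preds + n \<le> free \<and>
     (\<forall>v<n.
        (\<exists>xs. distinct xs \<and> set xs = E `` {v} \<and> stores_list h free (h (succs + v)) xs) \<and>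
        (\<exists>xs. distinct xs \<and> set xs = E\<inverse> `` {v} \<and> stores_list h free (h (preds + v)) xs))"

text \<open>The set \<open>A\<close> is stored, without repetitions, in \<open>k\<close> consecutive cells from \<open>a\<close> on.\<close>

definition stores_set :: "mem \<Rightarrow> nat \<Rightarrow> nat \<Rightarrow> nat set \<Rightarrow> bool" where
  "stores_set h a k A \<longleftrightarrow> bij_betw (\<lambda>i. h (a + i)) {..<k} A"

end

theory Submission
  imports Defs
begin

text \<open>Entering every visible vertex from its first visible predecessor only turns the visible part
  of the graph into a tree, which is traversed by forking over the successor lists. A subtree
  returns the number of its outputs and a pointer to a binary tree having these outputs as leaves.
  This traversal writes to the large memory only where two nonempty results are merged, in cells
  indexed by the child whose result is merged, so that \<open>S\<close> outputs cause at most \<open>S - 1\<close> merges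
  and no allocation is needed. A second parallel traversal, of the binary tree only, uses the stored
  leaf counts to give every output its position in the output array.\<close>

subsection \<open>Weakest preconditions with costs\<close>

text \<open>A traversal that marks visited vertices would pay one write per visible vertex and would
  race at vertices with several visible predecessors. Here the decision to enter a vertex is
  recomputed from its predecessor list by reads alone: bounded degree makes this constant work per
  edge, and traceability guarantees that no visible vertex is missed. In the first traversal all
  writes happen on the way up, after the recursive tasks have returned, so each of its tasks starts
  from the same large memory. The second traversal is separate because the position of an output
  depends on the number of outputs to its left, known only once the left part is finished. The
  recursion lives in the tree of tasks rather than in an explicit stack, so a constant number of
  small cells suffices. A list of at most \<open>d\<close> successors gives a chain of merges; hence
  the merge tree has height at most \<open>d\<close> times the number of vertices on a longest path.
  The numerical constants are generous and carry no further meaning.\<close>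

primrec base :: "comp \<Rightarrow> nat" where
  "base (Ops k) = k"
| "base (Rd a) = 1"
| "base (Wr a) = 0"
| "base (Ser s t) = base s + base t"
| "base (Par s t) = base s + base t"

text \<open>Keeping \<omega> out of \<open>base\<close> lets one analysis in natural numbers serve
  every \<omega> and both work bounds.\<close>

lemma work_eq: "work \<omega> t = real (base t) + \<omega> * real (num_writes t)"
  by (induction t) (auto simp: algebra_simps)

text \<open>At a join the memory of one child is overridden on the cells that the other wrote, so an
  unwritten cell keeps its old value on either side. Through this fact the bounds on
  \<open>written_cells\<close> in postconditions determine memory contents.\<close>

lemma exec_unchanged:
  assumes "exec C P c st t st'"
  shows "a \<notin> written_cells t \<Longrightarrow> snd st' a = snd st a"
  using assms by (induction rule: exec.induct) (auto simp: override_on_def)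

text \<open>Total correctness: termination and legality of all accesses are included. By
  \<open>exec_deterministic\<close> the existential quantifiers lose nothing.\<close>

definition wp :: "machine \<Rightarrow> com list \<Rightarrow> com \<Rightarrow> (comp \<Rightarrow> mem \<Rightarrow> mem \<Rightarrow> bool) \<Rightarrow> mem \<Rightarrow> mem \<Rightarrow> bool" where
  "wp C P c Q m h \<longleftrightarrow> (\<exists>t m' h'. exec C P c (m, h) t (m', h') \<and> Q t m' h')"

text \<open>The consequence rule also hands over the frame property, so that no postcondition has to
  mention unchanged cells.\<close>

lemma wp_mono:
  assumes "wp C P c Q m h"
    and "\<And>t m' h'. Q t m' h' \<Longrightarrow> (\<And>a. a \<notin> written_cells t \<Longrightarrow> h' a = h a) \<Longrightarrow> Q' t m' h'"
  shows "wp C P c Q' m h"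
proof -
  from assms(1) obtain t m' h' where t: "exec C P c (m, h) t (m', h')" "Q t m' h'"
    unfolding wp_def by blast
  have "Q' t m' h'"
    using t(2) exec_unchanged[OF t(1)] by (intro assms(2)) auto
  with t show ?thesis
    unfolding wp_def by blast
qed

lemma wp_Skip: "Q (Ops 1) m h \<Longrightarrow> wp C P Skip Q m h"
  unfolding wp_def by (blast intro: exec_Skip)

text \<open>In these rules values and addresses are variables tied by equations, so that a proof can
  name them by short terms instead of unfolded evaluations.\<close>

lemma wp_Assign:
  assumes "i < word_bound C" "i < small_size C" "legal C m e" "eval m e = x"
    and "Q (Ops (ops e + 2)) (m(i := x)) h"
  shows "wp C P (Assign (Num i) e) Q m h"
  using assms exec_Assign[of C m "Num i" e P h] unfolding wp_def by fastforce

lemma wp_Load: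
  assumes "i < word_bound C" "i < small_size C" "legal C m e" "eval m e = a"
    and "h a = x" "x < word_bound C"
    and "Q (Ser (Ops (ops e + 1)) (Rd a)) (m(i := x)) h"
  shows "wp C P (Load (Num i) e) Q m h"
  using assms exec_Load[of C m "Num i" e h P] unfolding wp_def by fastforce

lemma wp_Store:
  assumes "legal C m a" "legal C m e" "eval m a = b" "eval m e = x"
    and "Q (Ser (Ops (ops a + ops e)) (Wr b)) m (h(b := x))"
  shows "wp C P (Store a e) Q m h"
  using assms exec_Store[of C m a e P h] unfolding wp_def by fastforce

lemma wp_Eval_Pred:
  assumes "i < word_bound C" "i < small_size C" "legal C m e" "eval m e = v"
    and "Q (Ops (ops e + 2 + pred_cost C v)) (m(i := of_bool (vis_pred C v))) h"
  shows "wp C P (Eval_Pred (Num i) e) Q m h"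
  using assms exec_Eval_Pred[of C m "Num i" e P h] unfolding wp_def by fastforce

lemma wp_Seq:
  "wp C P c (\<lambda>s. wp C P d (\<lambda>t. Q (Ser s t))) m h \<Longrightarrow> wp C P (Seq c d) Q m h"
  unfolding wp_def by (blast intro: exec_Seq)

lemma wp_If:
  assumes "legal C m e"
    and "eval m e \<noteq> 0 \<Longrightarrow> wp C P c (\<lambda>t. Q (Ser (Ops (ops e + 1)) t)) m h"
    and "eval m e = 0 \<Longrightarrow> wp C P d (\<lambda>t. Q (Ser (Ops (ops e + 1)) t)) m h"
  shows "wp C P (If_Nonzero e c d) Q m h"
  using assms unfolding wp_def
  by (cases "eval m e = 0") (blast intro: exec_If_True exec_If_False)+

lemma wp_While_False:
  assumes "legal C m e" "eval m e = 0" "Q (Ops (ops e + 1)) m h"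
  shows "wp C P (While_Nonzero e c) Q m h"
  using assms exec_While_False[of C m e P c h] unfolding wp_def by blast

lemma wp_While_True:
  assumes "legal C m e" "eval m e \<noteq> 0"
    and "wp C P c (\<lambda>s. wp C P (While_Nonzero e c) (\<lambda>t. Q (Ser (Ops (ops e + 1)) (Ser s t)))) m h"
  shows "wp C P (While_Nonzero e c) Q m h"
  using assms unfolding wp_def by (blast intro: exec_While_True)

text \<open>The nesting of the two \<open>wp\<close> is no order in time: both children start from
  the same large memory \<open>h\<close>.\<close>

lemma wp_Fork:
  assumes "p < length P" "q < length P"
    and "\<forall>e\<in>set as \<union> set bs. legal C m e"
    and "length as \<le> small_size C" "length bs \<le> small_size C"
    and "length rs \<le> small_size C" "length ss \<le> small_size C"
    and "\<forall>r\<in>set rs \<union> set ss. r < small_size C"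
    and "P ! p = c" "P ! q = d" "map (eval m) as = us" "map (eval m) bs = vs"
    and "wp C P c (\<lambda>s m1 h1. wp C P d (\<lambda>t m2 h2. race_free s t \<and>
           Q (Ser (Ops (sum_list (map ops (as @ bs)) + length (as @ bs) + 1))
               (Ser (Par s t) (Ops (length (rs @ ss) + 1))))
             (receive ss 0 m2 (receive rs 0 m1 m)) (override_on h1 h2 (written_cells t)))
           (frame vs) h) (frame us) h"
  shows "wp C P (Fork p as rs q bs ss) Q m h"
proof -
  from assms(13) obtain s m1 h1 t m2 h2 where
    "exec C P c (frame us, h) s (m1, h1)" "exec C P d (frame vs, h) t (m2, h2)" "race_free s t"
    and Q: "Q (Ser (Ops (sum_list (map ops (as @ bs)) + length (as @ bs) + 1))
               (Ser (Par s t) (Ops (length (rs @ ss) + 1))))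
             (receive ss 0 m2 (receive rs 0 m1 m)) (override_on h1 h2 (written_cells t))"
    unfolding wp_def by blast
  then have "exec C P (Fork p as rs q bs ss) (m, h)
       (Ser (Ops (sum_list (map ops (as @ bs)) + length (as @ bs) + 1))
         (Ser (Par s t) (Ops (length (rs @ ss) + 1))))
       (receive ss 0 m2 (receive rs 0 m1 m), override_on h1 h2 (written_cells t))"
    using assms(1-12) by (intro exec_Fork) auto
  with Q show ?thesis
    unfolding wp_def by blast
qed

text \<open>The language has no sequential call; it is simulated by a fork whose second child is
  \<open>Skip\<close>, which touches no cell and therefore cannot race.\<close>

lemma wp_Call:
  assumes "p < length P" "q < length P" "P ! q = Skip"
    and "\<forall>e\<in>set as. legal C m e"
    and "length as \<le> small_size C" "length rs \<le> small_size C" "\<forall>r\<in>set rs. r < small_size C"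
    and "P ! p = c" "map (eval m) as = us"
    and "wp C P c (\<lambda>s m1 h1.
           Q (Ser (Ops (sum_list (map ops as) + length as + 1))
               (Ser (Par s (Ops 1)) (Ops (length rs + 1))))
             (receive rs 0 m1 m) h1) (frame us) h"
  shows "wp C P (Fork p as rs q [] []) Q m h"
proof (rule wp_Fork[where vs = "[]" and d = Skip])
  show "wp C P c (\<lambda>s m1 h1. wp C P Skip (\<lambda>t m2 h2. race_free s t \<and>
           Q (Ser (Ops (sum_list (map ops (as @ [])) + length (as @ []) + 1))
               (Ser (Par s t) (Ops (length (rs @ []) + 1))))
             (receive [] 0 m2 (receive rs 0 m1 m)) (override_on h1 h2 (written_cells t)))
           (frame []) h) (frame us) h"
    by (rule wp_mono[OF assms(10)], rule wp_Skip) (simp add: race_free_def)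
qed (use assms in auto)

subsection \<open>The program\<close>

abbreviation cell :: "nat \<Rightarrow> expr" where
  "cell i \<equiv> Cell (Num i)"

fun seq :: "com list \<Rightarrow> com" where
  "seq [] = Skip"
| "seq [c] = c"
| "seq (c # cs) = Seq c (seq cs)"

text \<open>The first cells of a task hold the arguments: \<open>n, r, succs, preds, free\<close> for
  \<open>main_proc\<close>, \<open>v, n, succs, preds, free\<close> for \<open>visit_proc\<close>, and the same followed by the bounds
  \<open>p, e\<close> of the remaining part of the successor list of \<open>v\<close> for \<open>children_proc\<close>; the latter two
  return the number of outputs and the root of a tree in cells 0 and 1. The arguments of
  \<open>emit_proc\<close> are the root of a tree, the address of its first output, \<open>n\<close> and \<open>free\<close>. Words
  below \<open>n\<close> denote leaves, and \<open>n + w\<close> denotes the branch at \<open>w\<close>, whose two children and number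
  of leaves on the left are stored in the cells \<open>free + w\<close>, \<open>free + n + w\<close> and
  \<open>free + 2 n + w\<close>.\<close>

definition main_proc :: com where
  "main_proc = seq
     [Eval_Pred (Num 5) (cell 1),
      If_Nonzero (cell 5)
        (Fork 1 [cell 1, cell 0, cell 2, cell 3, cell 4] [5, 6] 3 [] [])
        Skip,
      Assign (Num 7) (Add (cell 4) (Add (cell 0) (Add (cell 0) (cell 0)))),
      If_Nonzero (cell 5)
        (Fork 4 [cell 6, cell 7, cell 0, cell 4] [] 3 [] [])
        Skip,
      Assign (Num 0) (cell 7),
      Assign (Num 1) (cell 5)]"

definition visit_proc :: com where
  "visit_proc = seq
     [Load (Num 5) (Add (cell 2) (cell 0)),
      Load (Num 6) (cell 5),
      If_Nonzero (cell 6)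
        (Fork 2 [cell 0, cell 1, cell 2, cell 3, cell 4, Add (cell 5) (Num 1),
                 Add (Add (cell 5) (Num 1)) (cell 6)] [0, 1] 3 [] [])
        (seq [Assign (Num 1) (cell 0), Assign (Num 0) (Num 1)])]"

text \<open>The guard is the negation of the flag in cell 8. The pointer is advanced before each
  load because the first word of a stored list is its length. The end of the list is never tested:
  the loop is only entered when the list contains a visible vertex.\<close>

definition first_visible :: com where
  "first_visible = While_Nonzero (Sub (Num 1) (cell 8))
     (seq [Assign (Num 9) (Add (cell 9) (Num 1)),
           Load (Num 10) (cell 9),
           Eval_Pred (Num 8) (cell 10)])"

definition test_child :: com where
  "test_child = seq
     [Load (Num 7) (cell 5),
      Eval_Pred (Num 8) (cell 7),
      If_Nonzero (cell 8)
        (seq [Load (Num 9) (Add (cell 3) (cell 7)),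
              Assign (Num 8) (Num 0),
              first_visible,
              Assign (Num 8) (Equal (cell 10) (cell 0))])
        Skip]"

text \<open>Cells 8 and 9 hold count and root for the child in cell 7, cells 0 and 11 those for the
  rest of the list. The second root is kept out of cell 1 because that cell still holds
  \<open>n\<close>, which the table addresses and the new root need.\<close>

definition merge_results :: com where
  "merge_results = If_Nonzero (cell 8)
     (If_Nonzero (cell 0)
       (seq [Store (Add (cell 4) (cell 7)) (cell 9),
             Store (Add (Add (cell 4) (cell 1)) (cell 7)) (cell 11),
             Store (Add (Add (Add (cell 4) (cell 1)) (cell 1)) (cell 7)) (cell 8),
             Assign (Num 0) (Add (cell 8) (cell 0)),
             Assign (Num 1) (Add (cell 1) (cell 7))])
       (seq [Assign (Num 0) (cell 8), Assign (Num 1) (cell 9)]))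
     (Assign (Num 1) (cell 11))"

definition children_proc :: com where
  "children_proc = If_Nonzero (Sub (cell 6) (cell 5))
     (seq [test_child,
           If_Nonzero (cell 8)
             (Seq (Fork 1 [cell 7, cell 1, cell 2, cell 3, cell 4] [8, 9]
                        2 [cell 0, cell 1, cell 2, cell 3, cell 4, Add (cell 5) (Num 1), cell 6] [0, 11])
                  merge_results)
             (Fork 2 [cell 0, cell 1, cell 2, cell 3, cell 4, Add (cell 5) (Num 1), cell 6] [0, 1] 3 [] [])])
     (seq [Assign (Num 0) (Num 0), Assign (Num 1) (Num 0)])"

definition emit_proc :: com where
  "emit_proc = If_Nonzero (Less (cell 0) (cell 2))
     (Store (cell 1) (cell 0))
     (seq [Load (Num 4) (Add (cell 3) (Sub (cell 0) (cell 2))),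
           Load (Num 5) (Add (cell 3) (cell 0)),
           Load (Num 6) (Add (Add (cell 3) (cell 2)) (cell 0)),
           Fork 4 [cell 4, cell 1, cell 2, cell 3] []
                4 [cell 5, Add (cell 1) (cell 6), cell 2, cell 3] []])"

definition program :: "com list" where
  "program = [main_proc, visit_proc, children_proc, Skip, emit_proc]"


subsection \<open>Trees of outputs\<close>

datatype mtree = Lf nat | Br nat mtree mtree

primrec leaves :: "mtree \<Rightarrow> nat list" where
  "leaves (Lf v) = [v]"
| "leaves (Br w l r) = leaves l @ leaves r"

primrec branches :: "mtree \<Rightarrow> nat set" where
  "branches (Lf v) = {}"
| "branches (Br w l r) = insert w (branches l \<union> branches r)"

primrec height :: "mtree \<Rightarrow> nat" where
  "height (Lf v) = 0"
| "height (Br w l r) = Suc (max (height l) (height r))"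

primrec node_id :: "nat \<Rightarrow> mtree \<Rightarrow> nat" where
  "node_id n (Lf v) = v"
| "node_id n (Br w l r) = n + w"

primrec represents :: "mem \<Rightarrow> nat \<Rightarrow> nat \<Rightarrow> mtree \<Rightarrow> bool" where
  "represents h free n (Lf v) \<longleftrightarrow> True"
| "represents h free n (Br w l r) \<longleftrightarrow>
     h (free + w) = node_id n l \<and> h (free + n + w) = node_id n r \<and>
     h (free + n + n + w) = length (leaves l) \<and> represents h free n l \<and> represents h free n r"

definition table_cells :: "nat \<Rightarrow> nat \<Rightarrow> nat set \<Rightarrow> nat set" where
  "table_cells free n B = (\<Union>w\<in>B. {free + w, free + n + w, free + n + n + w})"

lemma represents_cong:
  assumes "represents h free n t" "\<And>a. a \<in> table_cells free n (branches t) \<Longrightarrow> h' a = h a"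
  shows "represents h' free n t"
  using assms by (induction t) (auto simp: table_cells_def)

lemma leaves_nonempty: "0 < length (leaves t)"
  by (induction t) auto

lemma node_id_less:
  assumes "set (leaves t) \<subseteq> {..<n}" "branches t \<subseteq> {..<n}"
  shows "node_id n t < 2 * n"
  using assms by (cases t) auto

lemma frame_nth: "i < length ws \<Longrightarrow> frame ws i = ws ! i"
  by (simp add: frame_def)

lemma program_nth:
  "program ! 0 = main_proc" "program ! 1 = visit_proc" "program ! 2 = children_proc"
  "program ! 3 = Skip" "program ! 4 = emit_proc" "length program = 5"
  by (simp_all add: program_def)

text \<open>A binary tree with \<open>L\<close> leaves has \<open>2 * L - 1\<close> nodes, hence the
  bound on \<open>base\<close>. Reads stay in the tables below \<open>free + 3 * n\<close> and
  writes above them, the two children filling adjacent intervals; this makes the fork race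
  free.\<close>

lemma wp_emit:
  assumes "20 \<le> small_size C" "20 * free \<le> word_bound C" "0 < free" "n \<le> free"
    and "represents h free n t" "distinct (leaves t)" "set (leaves t) \<subseteq> {..<n}" "branches t \<subseteq> {..<n}"
    and "free + 3 * n \<le> p" "p + length (leaves t) \<le> free + 4 * n"
  shows "wp C program emit_proc (\<lambda>s m' h'.
     base s \<le> 100 * (2 * length (leaves t) - 1) \<and>
     depth s \<le> 100 * (height t + 1) \<and>
     num_writes s = length (leaves t) \<and>
     read_cells s \<subseteq> {..<free + 3 * n} \<and>
     written_cells s = {p..<p + length (leaves t)} \<and>
     (\<forall>i<length (leaves t). h' (p + i) = leaves t ! i))
     (frame [node_id n t, p, n, free]) h"
  using assms(5-)
proof (induction t arbitrary: p h)
  case (Lf v)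
  show ?case
    unfolding emit_proc_def
    apply (rule wp_If)
    subgoal using Lf assms by (simp add: frame_nth)
     apply (rule wp_Store[where b = p and x = v])
    using Lf assms
    by (simp_all add: frame_nth)
next
  case (Br w l r)
  let ?l = "length (leaves l)" and ?r = "length (leaves r)"
  have lr: "node_id n l < 2 * n" "node_id n r < 2 * n"
    using Br.prems node_id_less by auto
  \<comment> \<open>Distinct leaves below \<open>n\<close> are at most \<open>n\<close> many, so the
    stored leaf count is a legal word.\<close>
  have "length (leaves (Br w l r)) \<le> card {..<n}"
    using Br.prems by (metis card_mono distinct_card finite_lessThan)
  then have len: "?l + ?r \<le> n"
    by simp
  have pos: "0 < ?l" "0 < ?r"
    using leaves_nonempty by auto
  have "w < n"
    using Br.prems by simp
  note b = this lr len assms(1-4) Br.prems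
  have IHl: "wp C program emit_proc (\<lambda>s m' h'.
     base s \<le> 100 * (2 * ?l - 1) \<and>
     depth s \<le> 100 * (height l + 1) \<and>
     num_writes s = ?l \<and>
     read_cells s \<subseteq> {..<free + 3 * n} \<and>
     written_cells s = {p..<p + ?l} \<and>
     (\<forall>i<?l. h' (p + i) = leaves l ! i))
     (frame [node_id n l, p, n, free]) h"
    using Br.prems by (intro Br.IH(1)) auto
  have IHr: "wp C program emit_proc (\<lambda>s m' h'.
     base s \<le> 100 * (2 * ?r - 1) \<and>
     depth s \<le> 100 * (height r + 1) \<and>
     num_writes s = ?r \<and>
     read_cells s \<subseteq> {..<free + 3 * n} \<and>
     written_cells s = {p + ?l..<p + ?l + ?r} \<and>
     (\<forall>i<?r. h' (p + ?l + i) = leaves r ! i))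
     (frame [node_id n r, p + ?l, n, free]) h"
    using Br.prems by (intro Br.IH(2)) auto
  show ?case
    unfolding emit_proc_def seq.simps
    apply (rule wp_If)
    apply (use b in \<open>simp_all add: frame_nth\<close>)[2]
    apply (rule wp_Seq, rule wp_Load[where a = "free + w" and x = "node_id n l"])
    apply (use b in \<open>simp_all add: frame_nth\<close>)[6]
    apply (rule wp_Seq, rule wp_Load[where a = "free + n + w" and x = "node_id n r"])
    apply (use b in \<open>simp_all add: frame_nth\<close>)[4]
    subgoal using b by (simp add: frame_nth add_ac)
    subgoal using b by simp
    apply (rule wp_Seq, rule wp_Load[where a = "free + n + n + w" and x = ?l])
    apply (use b in \<open>simp_all add: frame_nth\<close>)[4]
    subgoal using b by (simp add: frame_nth add_ac)
    subgoal using b by simp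
    apply (rule wp_Fork[where us = "[node_id n l, p, n, free]" and vs = "[node_id n r, p + ?l, n, free]",
      OF _ _ _ _ _ _ _ _ program_nth(5) program_nth(5)])
    subgoal by (simp add: program_def)
    subgoal by (simp add: program_def)
    apply (use b in \<open>simp_all add: frame_nth\<close>)[3]
    subgoal by simp
    subgoal by simp
    subgoal by simp
    subgoal by (simp add: frame_nth)
    subgoal by (simp add: frame_nth)
    apply (rule wp_mono[OF IHl], rule wp_mono[OF IHr])
    subgoal premises prems for s m1 h1 t m2 h2
      apply (intro conjI)
      subgoal using prems b unfolding race_free_def by (fastforce simp: subset_iff)
      subgoal
      proof -
        from prems have "base s \<le> 100 * (2 * ?l - 1)" "base t \<le> 100 * (2 * ?r - 1)"
          by blast+
        with pos show ?thesis
          by (simp del: length_greater_0_conv)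
      qed
      subgoal using prems by auto
      subgoal using prems by simp
      subgoal using prems b by auto
      subgoal using prems by auto
      subgoal
      proof (intro allI impI)
        fix i assume i: "i < length (leaves (Br w l r))"
        show "override_on h1 h2 (written_cells t) (p + i) = leaves (Br w l r) ! i"
        proof (cases "i < ?l")
          case True
          then show ?thesis
            using prems by (simp add: override_on_def nth_append)
        next
          case False
          with i have "i - ?l < ?r"
            by auto
          moreover have "\<forall>i<?r. h2 (p + ?l + i) = leaves r ! i"
            using prems by blast
          ultimately have "h2 (p + ?l + (i - ?l)) = leaves r ! (i - ?l)"
            by blast
          with False i show ?thesis
            using prems by (simp add: override_on_def nth_append)
        qed
      qed
      done
    done
qed

subsection \<open>The tree of visible vertices\<close>

text \<open>The element \<open>x\<close> is absorbed into the machine, whence the dummy argument of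
  type \<open>unit\<close>. The factor 20 covers all small cells in use and all addresses up to
  \<open>free + 4 * n\<close>.\<close>

locale tracing =
  fixes C :: machine and n r succs preds free d k :: nat and E :: "(nat \<times> nat) set" and h0 :: mem
  assumes dag: "rooted_dag {..<n} E r"
    and traceable: "traceable {..<n} E r (\<lambda>_::unit. vis_pred C) ()"
    and degree: "degree_le d {..<n} E"
    and pred_cost: "v < n \<Longrightarrow> pred_cost C v \<le> k"
    and graph: "stores_graph h0 n E succs preds free"
    and small_size: "20 \<le> small_size C"
    and word_bound: "20 * free \<le> word_bound C"
begin

abbreviation vis :: "nat \<Rightarrow> bool" where "vis \<equiv> vis_pred C"

definition succ_list :: "nat \<Rightarrow> nat list" where
  "succ_list v = (SOME xs. distinct xs \<and> set xs = E `` {v} \<and> stores_list h0 free (h0 (succs + v)) xs)"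

text \<open>The order is that of the memory and it matters: it decides which visible predecessor is
  the first.\<close>

definition pred_list :: "nat \<Rightarrow> nat list" where
  "pred_list v = (SOME xs. distinct xs \<and> set xs = E\<inverse> `` {v} \<and> stores_list h0 free (h0 (preds + v)) xs)"

lemma E_bounded: "(u, v) \<in> E \<Longrightarrow> u < n \<and> v < n"
  and acyclic_E: "acyclic E"
  and root_less: "r < n"
  using dag by (auto simp: rooted_dag_def)

lemma finite_E: "finite E"
  using dag finite_subset unfolding rooted_dag_def by blast

lemma tables: "succs + n \<le> free" "preds + n \<le> free"
  using graph by (auto simp: stores_graph_def)

lemma free_bounds: "0 < free" "n \<le> free"
  using tables root_less by auto

lemma succ_list:
  assumes "v < n"
  shows "distinct (succ_list v)" "set (succ_list v) = E `` {v}"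
    "stores_list h0 free (h0 (succs + v)) (succ_list v)"
proof -
  have "\<exists>xs. distinct xs \<and> set xs = E `` {v} \<and> stores_list h0 free (h0 (succs + v)) xs"
    using graph assms unfolding stores_graph_def by blast
  from someI_ex[OF this] show "distinct (succ_list v)" "set (succ_list v) = E `` {v}"
    "stores_list h0 free (h0 (succs + v)) (succ_list v)"
    unfolding succ_list_def by auto
qed

lemma pred_list:
  assumes "v < n"
  shows "distinct (pred_list v)" "set (pred_list v) = E\<inverse> `` {v}"
    "stores_list h0 free (h0 (preds + v)) (pred_list v)"
proof -
  have "\<exists>xs. distinct xs \<and> set xs = E\<inverse> `` {v} \<and> stores_list h0 free (h0 (preds + v)) xs"
    using graph assms unfolding stores_graph_def by blast
  from someI_ex[OF this] show "distinct (pred_list v)" "set (pred_list v) = E\<inverse> `` {v}"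
    "stores_list h0 free (h0 (preds + v)) (pred_list v)"
    unfolding pred_list_def by auto
qed

lemma length_adjacency:
  assumes "v < n"
  shows "length (succ_list v) \<le> d" "length (pred_list v) \<le> d"
proof -
  have "card (E `` {v}) + card (E\<inverse> `` {v}) \<le> d"
    using degree assms by (auto simp: degree_le_def)
  moreover have "length (succ_list v) = card (E `` {v})" "length (pred_list v) = card (E\<inverse> `` {v})"
    using succ_list pred_list assms by (metis distinct_card)+
  ultimately show "length (succ_list v) \<le> d" "length (pred_list v) \<le> d"
    by auto
qed

section \<open>The forest of first visible predecessors\<close>

definition T :: "(nat \<times> nat) set" where
  "T = {(v, w). w < n \<and> vis w \<and> find vis (pred_list w) = Some v}"

abbreviation sub :: "nat \<Rightarrow> nat set" where
  "sub v \<equiv> T\<^sup>* `` {v}"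

text \<open>The set \<open>W\<close> will be the remaining part of the successor list of
  \<open>v\<close>, so this is what a partly processed list still has to visit.\<close>

definition below :: "nat \<Rightarrow> nat set \<Rightarrow> nat set" where
  "below v W = (\<Union>w\<in>{w\<in>W. (v, w) \<in> T}. sub w)"

definition sinks :: "nat set \<Rightarrow> nat set" where
  "sinks A = {u \<in> A. E `` {u} = {}}"

lemma T_D:
  assumes "(v, w) \<in> T"
  shows "(v, w) \<in> E" "vis v" "vis w" "v < n" "w < n"
proof -
  have w: "w < n" "vis w" and "find vis (pred_list w) = Some v"
    using assms by (auto simp: T_def)
  then have "v \<in> set (pred_list w)" "vis v"
    by (auto simp: find_Some_iff)
  with pred_list(2)[OF w(1)] E_bounded w show "(v, w) \<in> E" "vis v" "vis w" "v < n" "w < n"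
    by auto
qed

lemma acyclic_T: "acyclic T"
  using acyclic_E by (rule acyclic_subset) (auto dest: T_D(1))

lemma no_cycle: "(v, w) \<in> T \<Longrightarrow> (w, v) \<notin> T\<^sup>*"
  using acyclic_T unfolding acyclic_def by (meson rtrancl_into_trancl2)

text \<open>Parents in \<open>T\<close> are unique, so two ancestors of a common vertex are
  comparable. But a nontrivial path from one child of \<open>v\<close> to another must make its last
  step from \<open>v\<close>, which closes a cycle.\<close>

lemma sub_disjoint:
  assumes "(v, w1) \<in> T" "(v, w2) \<in> T" "w1 \<noteq> w2"
  shows "sub w1 \<inter> sub w2 = {}"
proof -
  have not_reach: "(a, b) \<notin> T\<^sup>*" if "(v, a) \<in> T" "(v, b) \<in> T" "a \<noteq> b" for a b
  proof
    assume "(a, b) \<in> T\<^sup>*"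
    with that(3) obtain c where "(a, c) \<in> T\<^sup>*" "(c, b) \<in> T"
      by (meson rtranclE)
    with that(2) have "(a, v) \<in> T\<^sup>*"
      by (auto simp: T_def)
    with no_cycle that(1) show False
      by blast
  qed
  have "single_valued (T\<inverse>)"
    by (auto simp: single_valued_def T_def)
  then have "(w1, w2) \<in> (T\<inverse>)\<^sup>* \<or> (w2, w1) \<in> (T\<inverse>)\<^sup>*" if "u \<in> sub w1" "u \<in> sub w2" for u
    using that single_valued_confluent[of "T\<inverse>" u w1 w2] by (auto simp: rtrancl_converse)
  with not_reach assms show ?thesis
    by (auto simp: rtrancl_converse)
qed

lemma sub_subset:
  assumes "v < n" "vis v"
  shows "sub v \<subseteq> {u. u < n \<and> vis u}"
proof -
  have "u < n \<and> vis u" if "(v, u) \<in> T\<^sup>*" for u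
    using that assms by (induction) (auto dest: T_D)
  then show ?thesis
    by auto
qed

lemma below_subset: "below v W \<subseteq> {u. u < n \<and> vis u}"
  unfolding below_def using sub_subset T_D by blast

lemma finite_below: "finite (below v W)"
  using below_subset[of v W] by (rule finite_subset) auto

lemma sub_eq: "sub v = insert v (below v (E `` {v}))"
  unfolding below_def using T_D(1)
  by (auto elim: converse_rtranclE intro: converse_rtrancl_into_rtrancl)

lemma not_in_below: "v \<notin> below v W"
  using no_cycle by (auto simp: below_def)

lemma below_empty: "below v {} = {}"
  by (auto simp: below_def)

lemma below_insert_T: "(v, w) \<in> T \<Longrightarrow> below v (insert w W) = sub w \<union> below v W"
  and below_insert_not_T: "(v, w) \<notin> T \<Longrightarrow> below v (insert w W) = below v W"
  by (auto simp: below_def)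

lemma sub_below_disjoint:
  assumes "(v, w) \<in> T" "w \<notin> W"
  shows "sub w \<inter> below v W = {}"
  unfolding below_def using sub_disjoint[OF assms(1)] assms(2) by fastforce

text \<open>Here traceability enters: every visible vertex other than \<open>r\<close> has some
  visible predecessor, so the search in its list succeeds and yields a parent in \<open>T\<close>,
  to which the induction along \<open>E\<close> applies.\<close>

lemma reachable_from_root:
  assumes "v < n" "vis v"
  shows "(r, v) \<in> T\<^sup>*"
proof -
  have "wf E"
    using finite_acyclic_wf finite_E acyclic_E by blast
  then show ?thesis
    using assms
  proof (induction v rule: wf_induct_rule)
    case (less v)
    show ?case
    proof (cases "v = r")
      case False
      then obtain u where "u < n" "(u, v) \<in> E" "vis u"
        using traceable less.prems unfolding traceable_def by fastforce
      then have "find vis (pred_list v) \<noteq> None"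
        using pred_list(2)[OF less.prems(1)] by (auto simp: find_None_iff)
      then obtain w where "(w, v) \<in> T"
        using less.prems by (auto simp: T_def)
      with less.IH[of w] T_D[OF this] show ?thesis
        by (meson rtrancl.rtrancl_into_rtrancl)
    qed simp
  qed
qed

lemma sub_root: "vis r \<Longrightarrow> sub r = {v. v < n \<and> vis v}"
  using sub_subset[OF root_less] reachable_from_root by blast

lemma invisible_root:
  assumes "\<not> vis r" "v < n"
  shows "\<not> vis v"
proof
  assume "vis v"
  with reachable_from_root assms have "(r, v) \<in> T\<^sup>*"
    by blast
  with assms \<open>vis v\<close> show False
    by (metis T_D(2) converse_rtranclE)
qed

text \<open>The out-degree is given by \<open>card\<close>, which is 0 for infinite sets too;
  finiteness turns the condition into emptiness.\<close>

lemma output_eq: "output_set {..<n} E (\<lambda>_. vis_pred C) x = sinks {v. v < n \<and> vis v}"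
proof -
  have "finite (E `` {v})" for v
    using finite_E by (auto intro: finite_Image)
  then show ?thesis
    by (auto simp: output_set_def sinks_def)
qed

section \<open>Path lengths\<close>

lemma path_length_bounded: "\<exists>b. \<forall>w k. (u, w) \<in> E ^^ k \<longrightarrow> k \<le> b"
proof -
  have "wf (E\<inverse>)"
    using finite_acyclic_wf_converse finite_E acyclic_E by blast
  then show ?thesis
  proof (induction u rule: wf_induct_rule)
    case (less u)
    then have "\<forall>v\<in>E `` {u}. \<exists>b. \<forall>w k. (v, w) \<in> E ^^ k \<longrightarrow> k \<le> b"
      by blast
    then obtain b where b: "v \<in> E `` {u} \<Longrightarrow> (v, w) \<in> E ^^ k \<Longrightarrow> k \<le> b v" for v w k
      by metis
    \<comment> \<open>A sum in place of a maximum is crude but needs no case for vertices without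
      successors.\<close>
    have "k \<le> Suc (\<Sum>v\<in>E `` {u}. b v)" if path: "(u, w) \<in> E ^^ k" for w k
    proof (cases k)
      case (Suc k')
      with path obtain v where v: "(u, v) \<in> E" "(v, w) \<in> E ^^ k'"
        by (metis relpow_Suc_D2)
      then have "k' \<le> b v"
        using b by blast
      also have "b v \<le> (\<Sum>v\<in>E `` {u}. b v)"
        using v(1) finite_E by (intro member_le_sum) (auto intro: finite_Image)
      finally show ?thesis
        using Suc by simp
    qed simp
    then show ?case
      by blast
  qed
qed

text \<open>The \<open>Max\<close> in \<open>longest_path\<close> is only meaningful over a finite
  set, which the crude bound provides. The conclusion is the initial measure for the induction in
  \<open>wp_visit\<close>.\<close>

lemma no_long_path:
  assumes "v < n"
  shows "(E ^^ Suc (longest_path {..<n} E)) `` {v} = {}"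
proof -
  obtain b where b: "(u, w) \<in> E ^^ k \<Longrightarrow> k \<le> b u" for u w k
    using path_length_bounded by metis
  have "k \<le> (\<Sum>u<n. b u)" if "u < n" "(u, w) \<in> E ^^ k" for u w k
    using b[OF that(2)] member_le_sum[of u "{..<n}" b] that(1) by simp
  then have "{k. \<exists>u\<in>{..<n}. \<exists>v\<in>{..<n}. (u, v) \<in> E ^^ k} \<subseteq> {..\<Sum>u<n. b u}"
    by auto
  then have fin: "finite {k. \<exists>u\<in>{..<n}. \<exists>v\<in>{..<n}. (u, v) \<in> E ^^ k}"
    by (rule finite_subset) simp
  show ?thesis
  proof (rule ccontr)
    assume "\<not> ?thesis"
    then obtain w where w: "(v, w) \<in> E ^^ Suc (longest_path {..<n} E)"
      by blast
    then have "w < n"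
      by (auto dest: E_bounded)
    with w assms have "Suc (longest_path {..<n} E) \<le> longest_path {..<n} E"
      unfolding longest_path_def by (intro Max_ge[OF fin]) auto
    then show False
      by simp
  qed
qed

subsection \<open>Correctness and costs of the procedures\<close>

definition agree :: "mem \<Rightarrow> bool" where
  "agree h \<longleftrightarrow> (\<forall>a<free. h a = h0 a)"

definition quiet :: "nat \<Rightarrow> comp \<Rightarrow> bool" where
  "quiet b s \<longleftrightarrow> base s \<le> b \<and> depth s \<le> b \<and> num_writes s = 0 \<and>
     read_cells s \<subseteq> {..<free} \<and> written_cells s = {}"

lemma quiet_mono: "quiet b s \<Longrightarrow> b \<le> b' \<Longrightarrow> quiet b' s"
  by (auto simp: quiet_def)

text \<open>The bound on \<open>i\<close> is required even for empty \<open>A\<close>, where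
  \<open>i\<close> points to nothing: the word is still passed on and must be legal.\<close>

definition result :: "nat \<Rightarrow> nat \<Rightarrow> mem \<Rightarrow> nat set \<Rightarrow> nat set \<Rightarrow> nat \<Rightarrow> bool" where
  "result c i h A B H \<longleftrightarrow> c = card A \<and> i < 2 * n \<and>
     (A \<noteq> {} \<longrightarrow> (\<exists>t. represents h free n t \<and> node_id n t = i \<and> distinct (leaves t) \<and>
        set (leaves t) = A \<and> branches t \<subseteq> B \<and> height t \<le> H))"

lemma result_cong:
  assumes "result c i h A B H" "\<And>a. a \<in> table_cells free n B \<Longrightarrow> h' a = h a"
  shows "result c i h' A B H"
proof -
  have "represents h' free n t" if "represents h free n t" "branches t \<subseteq> B" for t
    using that(1) by (rule represents_cong) (use assms(2) that(2) in \<open>auto simp: table_cells_def\<close>)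
  with assms(1) show ?thesis
    unfolding result_def by blast
qed

lemma result_mono:
  assumes "result c i h A B H" "B \<subseteq> B'" "H \<le> H'"
  shows "result c i h A B' H'"
  using assms order_trans unfolding result_def by metis

text \<open>Indices below \<open>n\<close> keep the three tables in consecutive blocks of
  \<open>n\<close> cells, so distinct vertices never share a cell. This is the source of race
  freedom in the first traversal.\<close>

lemma table_cells_disjoint:
  assumes "A \<inter> B = {}" "A \<subseteq> {..<n}" "B \<subseteq> {..<n}"
  shows "table_cells free n A \<inter> table_cells free n B = {}"
  using assms unfolding table_cells_def by (fastforce simp: subset_iff disjoint_iff)

lemma words: "n \<le> free" "0 < free" "20 * free \<le> word_bound C" "20 \<le> small_size C" "r < n"
  "succs + n \<le> free" "preds + n \<le> free"
  using free_bounds word_bound small_size root_less tables by auto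

text \<open>The address \<open>q\<close> is that of the cell before the list: the length word at
  first, the preceding element for each suffix reached by the induction.\<close>

lemma wp_first_visible:
  assumes "find vis zs = Some u" "\<forall>i<length zs. h (q + 1 + i) = zs ! i" "q + length zs < free"
    and "set zs \<subseteq> {..<n}" "m 8 = 0" "m 9 = q"
  shows "wp C P first_visible (\<lambda>s m' h'. h' = h \<and> m' 8 = 1 \<and> m' 10 = u \<and>
     (\<forall>i. i \<notin> {8, 9, 10} \<longrightarrow> m' i = m i) \<and> quiet (30 + length zs * (30 + k)) s) m h"
  using assms
proof (induction zs arbitrary: q m)
  case (Cons z zs)
  have z: "z < n" "h (q + 1) = z" "pred_cost C z \<le> k"
    using Cons.prems(2,4) pred_cost by auto
  note b = words z Cons.prems(3,5,6)
  let ?m = "m(9 := q + 1, 10 := z, 8 := of_bool (vis z))"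
  show ?case
    unfolding first_visible_def
    apply (rule wp_While_True)
    apply (use b in \<open>simp_all\<close>)[2]
    unfolding seq.simps
    apply (rule wp_Seq, rule wp_Assign[where x = "q + 1"])
    apply (use b in \<open>simp_all\<close>)[4]
    apply (rule wp_Seq, rule wp_Load[where a = "q + 1" and x = z])
    apply (use b in \<open>simp_all\<close>)[6]
    apply (rule wp_Eval_Pred[where v = z])
    apply (use b in \<open>simp_all\<close>)[4]
    subgoal
    proof (cases "vis z")
      case True
      with Cons.prems(1) have "u = z"
        by simp
      with True b show ?thesis
        by (intro wp_While_False) (auto simp: quiet_def)
    next
      case False
      have *: "wp C P first_visible (\<lambda>s m' h'. h' = h \<and> m' 8 = 1 \<and> m' 10 = u \<and>
         (\<forall>i. i \<notin> {8, 9, 10} \<longrightarrow> m' i = ?m i) \<and> quiet (30 + length zs * (30 + k)) s) ?m h"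
      proof (rule Cons.IH)
        show "\<forall>i<length zs. h (q + 1 + 1 + i) = zs ! i"
        proof (intro allI impI)
          fix i assume "i < length zs"
          with Cons.prems(2)[rule_format, of "Suc i"] show "h (q + 1 + 1 + i) = zs ! i"
            by simp
        qed
      qed (use Cons.prems False in auto)
      show ?thesis
        using b False by (intro wp_mono[OF *[unfolded first_visible_def seq.simps]]) (auto simp: quiet_def)
    qed
    done
qed simp

definition test_bound :: nat where
  "test_bound = 80 + k + d * (30 + k)"

lemma wp_test_child:
  assumes "agree h" "v < n" "vis v" "(v, w) \<in> E" "m 0 = v" "m 3 = preds" "m 5 = p" "p < free" "h0 p = w"
  shows "wp C P test_child (\<lambda>s m' h'. h' = h \<and> m' 7 = w \<and> m' 8 = of_bool ((v, w) \<in> T) \<and>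
     (\<forall>i<7. m' i = m i) \<and> quiet test_bound s) m h"
proof -
  have w: "w < n" "h p = w" "pred_cost C w \<le> k"
    using E_bounded assms pred_cost by (auto simp: agree_def)
  define q where "q = h0 (preds + w)"
  have q: "h (preds + w) = q" "q + length (pred_list w) < free"
      "\<forall>i<length (pred_list w). h0 (q + 1 + i) = pred_list w ! i"
    using pred_list(3)[OF w(1)] w(1) words assms(1) by (auto simp: stores_list_def q_def agree_def)
  then have qh: "\<forall>i<length (pred_list w). h (q + 1 + i) = pred_list w ! i"
    using assms(1) by (simp add: agree_def)
  \<comment> \<open>The vertex \<open>v\<close> itself is a visible predecessor of \<open>w\<close>,
    so the scan stops inside the list.\<close>
  have "find vis (pred_list w) \<noteq> None"
    using pred_list(2)[OF w(1)] assms(3,4) by (auto simp: find_None_iff)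
  then obtain u where u: "find vis (pred_list w) = Some u"
    by auto
  then have "u \<in> set (pred_list w)"
    by (auto simp: find_Some_iff)
  with pred_list(2)[OF w(1)] have "u < n"
    by (auto dest: E_bounded)
  have set: "set (pred_list w) \<subseteq> {..<n}"
    using pred_list(2)[OF w(1)] by (auto dest: E_bounded)
  note b = words w assms(2-) q(1,2) \<open>u < n\<close>
  have len: "30 + length (pred_list w) * (30 + k) \<le> 30 + d * (30 + k)"
    using length_adjacency(2)[OF w(1)] by simp
  show ?thesis
    unfolding test_child_def seq.simps
    apply (rule wp_Seq, rule wp_Load[where a = p and x = w])
    apply (use b in \<open>simp_all\<close>)[6]
    apply (rule wp_Seq, rule wp_Eval_Pred[where v = w])
    apply (use b in \<open>simp_all\<close>)[4]
    apply (rule wp_If)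
    subgoal using b by simp
    subgoal premises prems
      apply (rule wp_Seq, rule wp_Load[where a = "preds + w" and x = q])
      apply (use b in \<open>simp_all\<close>)[6]
      apply (rule wp_Seq, rule wp_Assign[where x = 0])
      apply (use b in \<open>simp_all\<close>)[4]
      apply (rule wp_Seq, rule wp_mono, rule wp_first_visible[OF u qh q(2) set])
      subgoal by simp
      subgoal by simp
      subgoal for s m' h'
        apply (rule wp_Assign[where x = "of_bool (u = v)"])
        apply (use b in \<open>simp_all\<close>)[4]
        subgoal premises prems'
        proof -
          have "quiet (30 + d * (30 + k)) s"
            using prems' len quiet_mono by blast
          with prems' show ?thesis
            using b u prems by (simp add: quiet_def test_bound_def T_def)
        qed
        done
      done
    subgoal using b by (intro wp_Skip) (auto simp: quiet_def test_bound_def T_def)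
    done
qed

text \<open>The new branch is stored under \<open>w\<close>, which indexes no branch of either tree,
  so both trees survive the three writes. If one side is empty, the other is passed on and nothing
  is written.\<close>

lemma wp_merge_results:
  assumes "result (m 8) (m 9) h A1 B1 H1" "result (m 0) (m 11) h A2 B2 H2"
    and "A1 \<inter> A2 = {}" "B1 \<inter> B2 = {}" "w \<notin> B1" "w \<notin> B2" "w < n"
    and "A1 \<subseteq> {..<n}" "A2 \<subseteq> {..<n}" "B1 \<subseteq> {..<n}" "B2 \<subseteq> {..<n}"
    and "m 1 = n" "m 4 = free" "m 7 = w"
  shows "wp C P merge_results (\<lambda>s m' h'.
     base s \<le> 60 \<and> depth s \<le> 60 \<and> num_writes s \<le> (if A1 = {} \<or> A2 = {} then 0 else 3) \<and>
     read_cells s = {} \<and> written_cells s \<subseteq> table_cells free n {w} \<and>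
     result (m' 0) (m' 1) h' (A1 \<union> A2) (insert w (B1 \<union> B2)) (Suc (max H1 H2))) m h"
proof -
  have fin: "finite A1" "finite A2"
    using assms(8,9) finite_subset by blast+
  have "card (A1 \<union> A2) \<le> card {..<n}"
    using assms(8,9) by (intro card_mono) auto
  then have card: "card A1 + card A2 = card (A1 \<union> A2)" "card A1 + card A2 \<le> n"
    using assms(3) fin by (simp_all add: card_Un_disjoint)
  have m: "m 8 = card A1" "m 0 = card A2" "m 9 < 2 * n" "m 11 < 2 * n"
    using assms(1,2) by (auto simp: result_def)
  note b = words m card fin assms(7,12-)
  have res: "result (card A1) (m 9) h A1 (insert w (B1 \<union> B2)) (Suc (max H1 H2))"
       "result (card A2) (m 11) h A2 (insert w (B1 \<union> B2)) (Suc (max H1 H2))"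
    using assms(1,2) m by (auto elim!: result_mono)
  show ?thesis
    unfolding merge_results_def seq.simps
    apply (rule wp_If)
    subgoal using b by simp
    subgoal
      apply (rule wp_If)
      subgoal using b by simp
      subgoal premises prems
      proof -
        have ne: "A1 \<noteq> {}" "A2 \<noteq> {}"
          using prems b by auto
        then obtain t1 t2 where t1: "represents h free n t1" "node_id n t1 = m 9" "distinct (leaves t1)"
            "set (leaves t1) = A1" "branches t1 \<subseteq> B1" "height t1 \<le> H1"
          and t2: "represents h free n t2" "node_id n t2 = m 11" "distinct (leaves t2)"
            "set (leaves t2) = A2" "branches t2 \<subseteq> B2" "height t2 \<le> H2"
          using assms(1,2) unfolding result_def by blast
        define h' where "h' = h(free + w := m 9, free + n + w := m 11, free + n + n + w := m 8)"
        have same: "h' a = h a" if "a \<in> table_cells free n (branches t1) \<or> a \<in> table_cells free n (branches t2)" for a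
        proof -
          have "a \<in> table_cells free n (B1 \<union> B2)"
            using that t1(5) t2(5) by (auto simp: table_cells_def)
          moreover have "table_cells free n {w} \<inter> table_cells free n (B1 \<union> B2) = {}"
            using assms by (intro table_cells_disjoint) auto
          ultimately have "a \<notin> table_cells free n {w}"
            by blast
          then show ?thesis
            by (auto simp: h'_def table_cells_def)
        qed
        have "represents h' free n t1" "represents h' free n t2"
          using represents_cong t1(1) t2(1) same by blast+
        moreover have "length (leaves t1) = m 8"
          using t1(3,4) m by (metis distinct_card)
        moreover have "h' (free + w) = m 9" "h' (free + n + w) = m 11" "h' (free + n + n + w) = m 8"
          using assms(7) by (auto simp: h'_def)
        ultimately have "represents h' free n (Br w t1 t2)"
          using t1(2) t2(2) by simp
        then have "result (card A1 + card A2) (n + w) h' (A1 \<union> A2) (insert w (B1 \<union> B2)) (Suc (max H1 H2))"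
          unfolding result_def using t1 t2 assms(3,7) card
          by (intro conjI impI exI[of _ "Br w t1 t2"]) (auto simp: le_max_iff_disj)
        then show ?thesis
          apply -
          apply (rule wp_Seq, rule wp_Store[where b = "free + w" and x = "m 9"])
          apply (use b in \<open>simp_all\<close>)[4]
          apply (rule wp_Seq, rule wp_Store[where b = "free + n + w" and x = "m 11"])
          apply (use b in \<open>simp_all\<close>)[4]
          apply (rule wp_Seq, rule wp_Store[where b = "free + n + n + w" and x = "m 8"])
          apply (use b in \<open>simp_all\<close>)[4]
          apply (rule wp_Seq, rule wp_Assign[where x = "card A1 + card A2"])
          apply (use b in \<open>simp_all\<close>)[4]
          apply (rule wp_Assign[where x = "n + w"])
          apply (use b in \<open>simp_all\<close>)[4]
          subgoal using b ne by (simp add: h'_def table_cells_def)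
          done
      qed
      subgoal premises prems
      proof -
        have "A2 = {}"
          using prems b by auto
        then show ?thesis
          apply -
          apply (rule wp_Seq, rule wp_Assign[where x = "card A1"])
          apply (use b in \<open>simp_all\<close>)[4]
          apply (rule wp_Assign[where x = "m 9"])
          apply (use b in \<open>simp_all\<close>)[4]
          subgoal using res by simp
          done
      qed
      done
    subgoal premises prems
    proof -
      have "A1 = {}"
        using prems b by auto
      then show ?thesis
        apply -
        apply (rule wp_Assign[where x = "m 11"])
        apply (use b in \<open>simp_all\<close>)[4]
        subgoal using res b by simp
        done
    qed
    done
qed

section \<open>Cost invariants of the first traversal\<close>

definition child_bound :: nat where
  "child_bound = 300 + test_bound"

text \<open>A visible vertex pays for testing all its successors, the invisible ones included: at
  most \<open>d\<close> list entries and the end of the list.\<close>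

definition vertex_bound :: nat where
  "vertex_bound = 200 + child_bound * (d + 1)"

text \<open>The cells of \<open>v\<close> are left out because they belong to the merge at its
  parent. Truncated subtraction gives no writes for zero outputs as well as for one. The number
  \<open>i\<close> is a length that no path from \<open>v\<close> attains.\<close>

definition visited :: "nat \<Rightarrow> nat \<Rightarrow> comp \<Rightarrow> mem \<Rightarrow> mem \<Rightarrow> bool" where
  "visited i v s m h \<longleftrightarrow>
     base s \<le> vertex_bound * card (sub v) \<and>
     depth s \<le> vertex_bound * i \<and>
     num_writes s \<le> 3 * (card (sinks (sub v)) - 1) \<and>
     read_cells s \<subseteq> {..<free} \<and>
     written_cells s \<subseteq> table_cells free n (sub v - {v}) \<and>
     result (m 0) (m 1) h (sinks (sub v)) (sub v - {v}) (d * i)"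

definition listed :: "nat \<Rightarrow> nat \<Rightarrow> nat list \<Rightarrow> comp \<Rightarrow> mem \<Rightarrow> mem \<Rightarrow> bool" where
  "listed i v ys s m h \<longleftrightarrow>
     base s \<le> child_bound * (length ys + 1) + vertex_bound * card (below v (set ys)) \<and>
     depth s \<le> child_bound * (length ys + 1) + vertex_bound * i \<and>
     num_writes s \<le> 3 * (card (sinks (below v (set ys))) - 1) \<and>
     read_cells s \<subseteq> {..<free} \<and>
     written_cells s \<subseteq> table_cells free n (below v (set ys)) \<and>
     result (m 0) (m 1) h (sinks (below v (set ys))) (below v (set ys)) (length ys + d * i)"

lemma sinks_Un: "sinks (A \<union> B) = sinks A \<union> sinks B"
  by (auto simp: sinks_def)

lemma sinks_subset: "sinks A \<subseteq> A"
  by (auto simp: sinks_def)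

text \<open>Assuming the specification of \<open>visit_proc\<close> for the children breaks the
  mutual recursion: lists are handled here, path lengths in \<open>wp_visit\<close>. The same
  \<open>h\<close> serves all recursive tasks, as they all start before any merge.\<close>

lemma wp_children:
  assumes "agree h" "v < n" "vis v" "e \<le> free"
    and "\<And>w. w \<in> set ys \<Longrightarrow> (v, w) \<in> T \<Longrightarrow>
      wp C program visit_proc (visited i w) (frame [w, n, succs, preds, free]) h"
    and "distinct ys" "set ys \<subseteq> E `` {v}" "p + length ys = e" "\<forall>j<length ys. h0 (p + j) = ys ! j"
  shows "wp C program children_proc (listed i v ys) (frame [v, n, succs, preds, free, p, e]) h"
  using assms(5-)
proof (induction ys arbitrary: p)
  case Nil
  note b = words assms(2,4) Nil.prems(4)
  show ?case
    unfolding children_proc_def seq.simps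
    apply (rule wp_If)
    apply (use b in \<open>simp_all add: frame_nth\<close>)[2]
    apply (rule wp_Seq, rule wp_Assign[where x = 0])
    apply (use b in \<open>simp_all\<close>)[4]
    apply (rule wp_Assign[where x = 0])
    apply (use b in \<open>simp_all\<close>)[4]
    subgoal using b by (simp add: listed_def below_empty sinks_def result_def child_bound_def)
    done
next
  case (Cons w ys)
  have w: "(v, w) \<in> E" "w < n" "p < free" "h0 p = w"
    using Cons.prems E_bounded assms(4) by auto
  note b = words assms(2,4) w Cons.prems(4)
  have IH: "wp C program children_proc (listed i v ys) (frame [v, n, succs, preds, free, p + 1, e]) h"
  proof (rule Cons.IH)
    show "\<forall>j<length ys. h0 (p + 1 + j) = ys ! j"
    proof (intro allI impI)
      fix j assume "j < length ys"
      with Cons.prems(5)[rule_format, of "Suc j"] show "h0 (p + 1 + j) = ys ! j"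
        by simp
    qed
  qed (use Cons.prems in auto)
  let ?m = "frame [v, n, succs, preds, free, p, e]"
  show ?case
    unfolding children_proc_def seq.simps
    apply (rule wp_If)
    subgoal using b by (simp add: frame_nth)
     apply (rule wp_Seq, rule wp_mono, rule wp_test_child[OF assms(1-3) w(1) _ _ _ w(3,4)])
    subgoal by (simp add: frame_nth)
    subgoal by (simp add: frame_nth)
    subgoal by (simp add: frame_nth)
    subgoal premises prems for s0 m h'
    proof -
      have h': "h' = h" and m7: "m 7 = w" and m8: "m 8 = of_bool ((v, w) \<in> T)"
        and q: "quiet test_bound s0" and args: "\<forall>i<7. m i = ?m i"
        using prems by auto
      have m: "m 0 = v" "m 1 = n" "m 2 = succs" "m 3 = preds" "m 4 = free" "m 5 = p" "m 6 = e"
        using args by (simp_all add: frame_nth)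
      note b = b m m7 m8
      show ?thesis
        unfolding h'
        apply (rule wp_If)
        subgoal using b by simp
        subgoal premises prems
        proof -
          have T: "(v, w) \<in> T"
            using prems m8 by simp
          have visit: "wp C program visit_proc (visited i w) (frame [w, n, succs, preds, free]) h"
            using Cons.prems(1) T by simp
          let ?B = "below v (set ys)"
          have w_notin: "w \<notin> set ys"
            using Cons.prems(2) by simp
          \<comment> \<open>Disjointness has three uses: the fork is race free, the cardinalities
            that bound the costs add up, and both trees remain intact when the memories are
            combined.\<close>
          have disj: "sub w \<inter> ?B = {}"
            by (rule sub_below_disjoint[OF T w_notin])
          have sub: "sub w \<subseteq> {..<n}" "?B \<subseteq> {..<n}"
            using sub_subset[of w] T_D[OF T] below_subset[of v "set ys"] by auto
          then have fin: "finite (sub w)" "finite ?B"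
            using finite_subset by blast+
          have below_eq: "below v (set (w # ys)) = sub w \<union> ?B"
            using below_insert_T[OF T] by simp
          have card_below: "card (below v (set (w # ys))) = card (sub w) + card ?B"
            unfolding below_eq by (rule card_Un_disjoint[OF fin disj])
          have disj_sinks: "sinks (sub w) \<inter> sinks ?B = {}"
            using disj sinks_subset by blast
          have fin_sinks: "finite (sinks (sub w))" "finite (sinks ?B)"
            using fin sinks_subset finite_subset by metis+
          have card_sinks: "card (sinks (below v (set (w # ys)))) = card (sinks (sub w)) + card (sinks ?B)"
            unfolding below_eq sinks_Un by (rule card_Un_disjoint[OF fin_sinks disj_sinks])
          have table_disj: "table_cells free n (sub w - {w}) \<inter> table_cells free n ?B = {}"
            using disj sub by (intro table_cells_disjoint) auto
          have table_ge: "table_cells free n A \<inter> {..<free} = {}" for A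
            by (auto simp: table_cells_def)
          show ?thesis
            apply (rule wp_Seq)
            apply (rule wp_Fork[where us = "[w, n, succs, preds, free]"
                  and vs = "[v, n, succs, preds, free, p + 1, e]",
                  OF _ _ _ _ _ _ _ _ program_nth(2) program_nth(3)])
            subgoal by (simp add: program_def)
            subgoal by (simp add: program_def)
            apply (use b in \<open>simp_all\<close>)[8]
            apply (rule wp_mono[OF visit], rule wp_mono[OF IH])
            subgoal premises prems for s m1 h1 t m2 h2
            proof (intro conjI)
              have s: "visited i w s m1 h1" and t: "listed i v ys t m2 h2"
                and s_same: "\<And>a. a \<notin> written_cells s \<Longrightarrow> h1 a = h a"
                and t_same: "\<And>a. a \<notin> written_cells t \<Longrightarrow> h2 a = h a"
                using prems by auto
              have rw: "read_cells s \<subseteq> {..<free}" "read_cells t \<subseteq> {..<free}"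
                "written_cells s \<subseteq> table_cells free n (sub w - {w})"
                "written_cells t \<subseteq> table_cells free n ?B"
                using s t by (auto simp: visited_def listed_def)
              then show "race_free s t"
                unfolding race_free_def using table_disj table_ge by blast
              define h3 where "h3 = override_on h1 h2 (written_cells t)"
              have res1: "result (m1 0) (m1 1) h3 (sinks (sub w)) (sub w - {w}) (d * i)"
              proof (rule result_cong)
                show "result (m1 0) (m1 1) h1 (sinks (sub w)) (sub w - {w}) (d * i)"
                  using s by (simp add: visited_def)
                show "h3 a = h1 a" if "a \<in> table_cells free n (sub w - {w})" for a
                  using that rw(4) table_disj by (auto simp: h3_def override_on_def)
              qed
              have res2: "result (m2 0) (m2 1) h3 (sinks ?B) ?B (length ys + d * i)"
              proof (rule result_cong)
                show "result (m2 0) (m2 1) h2 (sinks ?B) ?B (length ys + d * i)"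
                  using t by (simp add: listed_def)
                show "h3 a = h2 a" if "a \<in> table_cells free n ?B" for a
                \<comment> \<open>A cell in the tables of \<open>?B\<close> that the second child
                  did not write was not written by the first either, so both memories still hold the
                  value from \<open>h\<close>.\<close>
                proof (cases "a \<in> written_cells t")
                  case False
                  moreover have "a \<notin> written_cells s"
                    using that rw(3) table_disj by blast
                  ultimately show ?thesis
                    using s_same t_same by (simp add: h3_def)
                qed (simp add: h3_def)
              qed
              let ?m3 = "receive [0, 11] 0 m2 (receive [8, 9] 0 m1 m)"
              have *: "wp C program merge_results (\<lambda>s m' h'.
                 base s \<le> 60 \<and> depth s \<le> 60 \<and>
                 num_writes s \<le> (if sinks (sub w) = {} \<or> sinks ?B = {} then 0 else 3) \<and>
                 read_cells s = {} \<and> written_cells s \<subseteq> table_cells free n {w} \<and>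
                 result (m' 0) (m' 1) h' (sinks (sub w) \<union> sinks ?B) (insert w ((sub w - {w}) \<union> ?B))
                   (Suc (max (d * i) (length ys + d * i)))) ?m3 h3"
                using res1 res2 disj disj_sinks sub b sinks_subset[of "sub w"] sinks_subset[of ?B]
                by (intro wp_merge_results) auto
              show "wp C program merge_results (\<lambda>u. listed i v (w # ys)
                  (Ser (Ops (ops (Sub (cell 6) (cell 5)) + 1))
                    (Ser s0 (Ser (Ops (ops (cell 8) + 1)) (Ser
                      (Ser (Ops (sum_list (map ops ([cell 7, cell 1, cell 2, cell 3, cell 4] @
                          [cell 0, cell 1, cell 2, cell 3, cell 4, Add (cell 5) (Num 1), cell 6])) +
                         length ([cell 7, cell 1, cell 2, cell 3, cell 4] @
                          [cell 0, cell 1, cell 2, cell 3, cell 4, Add (cell 5) (Num 1), cell 6]) + 1))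
                      (Ser (Par s t) (Ops (length ([8, 9] @ [0, 11 :: nat]) + 1)))) u)))))
                  ?m3 (override_on h1 h2 (written_cells t))"
                unfolding h3_def[symmetric]
                apply (rule wp_mono[OF *])
                subgoal premises prems for u m' h'
                proof -
                  have qs: "base s0 \<le> test_bound" "depth s0 \<le> test_bound" "num_writes s0 = 0"
                    "read_cells s0 \<subseteq> {..<free}" "written_cells s0 = {}"
                    using q by (auto simp: quiet_def)
                  have us: "base u \<le> 60" "depth u \<le> 60" "read_cells u = {}"
                    "written_cells u \<subseteq> table_cells free n {w}"
                    "num_writes u \<le> (if sinks (sub w) = {} \<or> sinks ?B = {} then 0 else 3)"
                    using prems by blast+
                  have eq: "insert w ((sub w - {w}) \<union> ?B) = below v (set (w # ys))"
                    unfolding below_eq by auto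
                  have res: "result (m' 0) (m' 1) h' (sinks (below v (set (w # ys))))
                      (below v (set (w # ys))) (length (w # ys) + d * i)"
                    using prems unfolding eq sinks_Un[symmetric] below_eq[symmetric] by simp
                  have nw: "num_writes s \<le> 3 * (card (sinks (sub w)) - 1)"
                    "num_writes t \<le> 3 * (card (sinks ?B) - 1)"
                    using s t by (auto simp: visited_def listed_def)
                  \<comment> \<open>For counts \<open>a\<close> and \<open>b\<close> that are both
                    positive, \<open>3 * (a - 1) + 3 * (b - 1) + 3 = 3 * (a + b - 1)\<close>: the
                    merge uses up exactly the slack. Otherwise it writes nothing.\<close>
                  have "num_writes s + num_writes t + num_writes u
                    \<le> 3 * (card (sinks (sub w)) + card (sinks ?B) - 1)"
                  proof (cases "sinks (sub w) = {} \<or> sinks ?B = {}")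
                    case True
                    with us(5) nw show ?thesis
                      by auto
                  next
                    case False
                    then have "card (sinks (sub w)) > 0" "card (sinks ?B) > 0"
                      using fin_sinks by (auto simp: card_gt_0_iff)
                    with us(5) nw False show ?thesis
                      by simp
                  qed
                  moreover have "base s \<le> vertex_bound * card (sub w)" "depth s \<le> vertex_bound * i"
                    using s by (auto simp: visited_def)
                  moreover have "base t \<le> child_bound * (length ys + 1) + vertex_bound * card ?B"
                    "depth t \<le> child_bound * (length ys + 1) + vertex_bound * i"
                    using t by (auto simp: listed_def)
                  moreover have "written_cells s \<union> written_cells t \<union> written_cells u
                    \<subseteq> table_cells free n (below v (set (w # ys)))"
                    using rw us(4) unfolding below_eq by (auto simp: table_cells_def)
                  ultimately show ?thesis
                    unfolding listed_def card_below card_sinks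
                    using res qs us rw by (simp add: child_bound_def algebra_simps)
                qed
                done
            qed
            done
        qed
        subgoal premises prems
        proof -
          have T: "(v, w) \<notin> T"
            using prems m8 by simp
          have below_eq: "below v (set (w # ys)) = below v (set ys)"
            using below_insert_not_T[OF T] by simp
          show ?thesis
            apply (rule wp_Call[where us = "[v, n, succs, preds, free, p + 1, e]",
                  OF _ _ program_nth(4) _ _ _ _ program_nth(3)])
            subgoal by (simp add: program_def)
            subgoal by (simp add: program_def)
            apply (use b in \<open>simp_all\<close>)[5]
            apply (rule wp_mono[OF IH])
            subgoal for t m' h'
              unfolding listed_def below_eq using q
              by (auto simp: quiet_def child_bound_def algebra_simps elim: result_mono)
            done
        qed
        done
    qed
    subgoal using b by (simp add: frame_nth)
    done
qed

text \<open>Induction on a path length instead of on \<open>E\<close> keeps the measure available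
  for the bounds on depth and height. The base case is void since the relation power 0 relates
  \<open>v\<close> to itself.\<close>

lemma wp_visit:
  assumes "agree h" "v < n" "vis v" "(E ^^ i) `` {v} = {}"
  shows "wp C program visit_proc (visited i v) (frame [v, n, succs, preds, free]) h"
  using assms(2-)
proof (induction i arbitrary: v)
  case (Suc i)
  define xs where "xs = succ_list v"
  define p where "p = h0 (succs + v)"
  have xs: "distinct xs" "set xs = E `` {v}" "length xs \<le> d"
    using succ_list length_adjacency Suc.prems(1) by (auto simp: xs_def)
  have "stores_list h0 free p xs"
    using succ_list(3)[OF Suc.prems(1)] by (simp add: xs_def p_def)
  then have p: "p + 1 + length xs \<le> free" "h0 p = length xs" "\<forall>j<length xs. h0 (p + 1 + j) = xs ! j"
    by (auto simp: stores_list_def)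
  have h: "h (succs + v) = p" "h p = length xs"
    using assms(1) p words Suc.prems(1) by (auto simp: agree_def p_def)
  have sub_below: "sub v = insert v (below v (set xs))" "v \<notin> below v (set xs)"
    using sub_eq[of v] not_in_below[of v] xs(2) by simp_all
  then have below_eq: "sub v - {v} = below v (set xs)"
    by auto
  have card_sub: "card (sub v) = Suc (card (below v (set xs)))"
    unfolding sub_below(1) using sub_below(2) finite_below by simp
  have "child_bound * (length xs + 1) \<le> child_bound * (d + 1)"
    using xs(3) by (intro mult_le_mono) auto
  then have len: "child_bound * (length xs + 1) + 200 \<le> vertex_bound"
    unfolding vertex_bound_def by linarith
  note b = words Suc.prems(1) p(1,2) h
  have children: "wp C program children_proc (listed i v xs)
      (frame [v, n, succs, preds, free, p + 1, p + 1 + length xs]) h"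
  proof (rule wp_children[OF assms(1) Suc.prems(1,2) p(1)])
    fix w assume "w \<in> set xs" "(v, w) \<in> T"
    then have w: "(v, w) \<in> E" "w < n" "vis w"
      using T_D by auto
    have "(w, u) \<notin> E ^^ i" for u
      using relpow_Suc_I2[OF w(1), of u i] Suc.prems(3) by blast
    then show "wp C program visit_proc (visited i w) (frame [w, n, succs, preds, free]) h"
      using w by (intro Suc.IH) auto
  qed (use xs p in auto)
  show ?case
    unfolding visit_proc_def seq.simps
    apply (rule wp_Seq, rule wp_Load[where a = "succs + v" and x = p])
    apply (use b in \<open>simp_all add: frame_nth\<close>)[6]
    apply (rule wp_Seq, rule wp_Load[where a = p and x = "length xs"])
    apply (use b in \<open>simp_all add: frame_nth\<close>)[6]
    apply (rule wp_If)
    subgoal using b by (simp add: frame_nth)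
    subgoal premises prems
    proof -
      have "E `` {v} \<noteq> {}"
        using prems xs(2) by (auto simp: frame_nth)
      then have sinks_eq: "sinks (sub v) = sinks (below v (set xs))"
        unfolding sub_below(1) by (auto simp: sinks_def)
      show ?thesis
        apply (rule wp_Call[where us = "[v, n, succs, preds, free, p + 1, p + 1 + length xs]",
              OF _ _ program_nth(4) _ _ _ _ program_nth(3)])
        subgoal by (simp add: program_def)
        subgoal by (simp add: program_def)
        apply (use b in \<open>simp_all add: frame_nth\<close>)[5]
        apply (rule wp_mono[OF children])
        subgoal for t m' h'
          unfolding visited_def listed_def below_eq sinks_eq card_sub using len xs(3) b
          by (auto elim: result_mono)
        done
    qed
    subgoal premises prems
    proof -
      have "E `` {v} = {}"
        using prems xs(2) by (auto simp: frame_nth)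
      then have "sub v = {v}" "sinks (sub v) = {v}"
        using sub_below xs(2) by (auto simp: below_empty sinks_def)
      moreover have "result 1 v h {v} {} (d * Suc i)"
        using Suc.prems(1) by (auto simp: result_def intro!: exI[of _ "Lf v"])
      ultimately show ?thesis
        apply -
        apply (rule wp_Seq, rule wp_Assign[where x = v])
        apply (use b in \<open>simp_all add: frame_nth\<close>)[4]
        apply (rule wp_Assign[where x = 1])
        apply (use b in \<open>simp_all add: frame_nth\<close>)[4]
        subgoal using b by (simp add: visited_def vertex_bound_def)
        done
    qed
    done
qed simp

section \<open>The complete run\<close>

abbreviation "visible_vertices \<equiv> {v. v < n \<and> vis v}"
abbreviation "path_bound \<equiv> Suc (longest_path {..<n} E)"

text \<open>Cell 5 first holds the truth value at the root and then the number of outputs. If the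
  root is invisible, nothing is visible, and the zeros in cells 5 and 6 already are a valid empty
  result.\<close>

lemma wp_trace_root:
  assumes "\<forall>i<5. m i = [n, r, succs, preds, free] ! i" "m 5 = of_bool (vis r)" "m 6 = 0"
  shows "wp C program
     (If_Nonzero (cell 5) (Fork 1 [cell 1, cell 0, cell 2, cell 3, cell 4] [5, 6] 3 [] []) Skip)
     (\<lambda>s m' h'. (\<forall>i<5. m' i = m i) \<and>
        result (m' 5) (m' 6) h' (sinks visible_vertices) visible_vertices (d * path_bound) \<and>
        base s \<le> 100 + vertex_bound * card visible_vertices \<and>
        depth s \<le> 100 + vertex_bound * path_bound \<and>
        num_writes s \<le> 3 * card (sinks visible_vertices) \<and>
        written_cells s \<subseteq> {free..})
     m h0"
proof -
  have m: "m 0 = n" "m 1 = r" "m 2 = succs" "m 3 = preds" "m 4 = free"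
    using assms(1) by (simp_all add: numeral_nat)
  note b = words m assms(2,3)
  have table: "table_cells free n B \<subseteq> {free..}" for B
    by (auto simp: table_cells_def)
  show ?thesis
    apply (rule wp_If)
    subgoal using b by simp
    subgoal premises prems
    proof -
      have r: "vis r"
        using prems b by (cases "vis r") auto
      have visit: "wp C program visit_proc (visited path_bound r) (frame [r, n, succs, preds, free]) h0"
        by (intro wp_visit r words no_long_path) (simp add: agree_def)
      show ?thesis
        apply (rule wp_Call[where us = "[r, n, succs, preds, free]",
              OF _ _ program_nth(4) _ _ _ _ program_nth(2)])
        subgoal by (simp add: program_def)
        subgoal by (simp add: program_def)
        apply (use b in \<open>simp_all\<close>)[5]
        apply (rule wp_mono[OF visit])
        subgoal for s m1 h1
          using table[of "visible_vertices - {r}"] unfolding visited_def sub_root[OF r]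
          by (auto elim: result_mono)
        done
    qed
    subgoal premises prems
    proof -
      have "\<not> vis r"
        using prems b by (cases "vis r") auto
      then have none: "visible_vertices = {}"
        using invisible_root by auto
      show ?thesis
        unfolding none using b \<open>\<not> vis r\<close> by (intro wp_Skip) (auto simp: result_def sinks_def)
    qed
    done
qed

text \<open>The factor 4 for the writes is three per merge and one per entry of the output
  array.\<close>

lemma wp_main:
  "wp C program main_proc (\<lambda>s m' h'.
     stores_set h' (m' 0) (m' 1) (sinks visible_vertices) \<and>
     written_cells s \<subseteq> {free..} \<and>
     base s \<le> 1000 + vertex_bound * (card visible_vertices + 1) + 200 * card (sinks visible_vertices) \<and>
     depth s \<le> 1000 + vertex_bound * (path_bound + 1) + 100 * (d * path_bound + 1) \<and>
     num_writes s \<le> 4 * card (sinks visible_vertices))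
     (frame [n, r, succs, preds, free]) h0"
proof -
  let ?S = "sinks visible_vertices"
  let ?m = "(frame [n, r, succs, preds, free])(5 := of_bool (vis r))"
  show ?thesis
    unfolding main_proc_def seq.simps
    apply (rule wp_Seq, rule wp_Eval_Pred[where v = r])
    apply (use words in \<open>simp_all add: frame_nth\<close>)[4]
    apply (rule wp_Seq, rule wp_mono, rule wp_trace_root)
    subgoal by (simp add: frame_nth)
    subgoal by simp
    subgoal by (simp add: frame_def)
    subgoal premises prems for s m h
    proof -
      have m: "m 0 = n" "m 1 = r" "m 2 = succs" "m 3 = preds" "m 4 = free"
        using prems by (auto simp: frame_nth)
      have res: "result (m 5) (m 6) h ?S visible_vertices (d * path_bound)"
        and s: "base s \<le> 100 + vertex_bound * card visible_vertices"
          "depth s \<le> 100 + vertex_bound * path_bound" "num_writes s \<le> 3 * card ?S"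
          "written_cells s \<subseteq> {free..}"
        using prems by auto
      have r_cost: "pred_cost C r \<le> vertex_bound"
        using pred_cost[OF root_less] by (simp add: vertex_bound_def child_bound_def test_bound_def)
      have "card ?S \<le> card {..<n}"
        using sinks_subset by (intro card_mono) auto
      then have m56: "m 5 = card ?S" "m 6 < 2 * n" "card ?S \<le> n"
        using res by (auto simp: result_def)
      note b = words m m56
      show ?thesis
        apply (rule wp_Seq, rule wp_Assign[where x = "free + 3 * n"])
        apply (use b in \<open>simp_all\<close>)[4]
        apply (rule wp_Seq, rule wp_If)
        subgoal using b by simp
        subgoal premises prems
        proof -
          have "?S \<noteq> {}"
            using prems m56 by auto
          then obtain t where t: "represents h free n t" "node_id n t = m 6" "distinct (leaves t)"
              "set (leaves t) = ?S" "branches t \<subseteq> visible_vertices" "height t \<le> d * path_bound"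
            using res by (auto simp: result_def)
          have length: "length (leaves t) = card ?S"
            using t(3,4) by (metis distinct_card)
          have emit: "wp C program emit_proc (\<lambda>s m' h'.
             base s \<le> 100 * (2 * length (leaves t) - 1) \<and>
             depth s \<le> 100 * (height t + 1) \<and>
             num_writes s = length (leaves t) \<and>
             read_cells s \<subseteq> {..<free + 3 * n} \<and>
             written_cells s = {free + 3 * n..<free + 3 * n + length (leaves t)} \<and>
             (\<forall>i<length (leaves t). h' (free + 3 * n + i) = leaves t ! i))
             (frame [m 6, free + 3 * n, n, free]) h"
            unfolding t(2)[symmetric] using t length m56 words sinks_subset[of visible_vertices]
            by (intro wp_emit) auto
          show ?thesis
            apply (rule wp_Call[where us = "[m 6, free + 3 * n, n, free]",
                  OF _ _ program_nth(4) _ _ _ _ program_nth(5)])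
            subgoal by (simp add: program_def)
            subgoal by (simp add: program_def)
            apply (use b in \<open>simp_all\<close>)[5]
            apply (rule wp_mono[OF emit])
            subgoal premises prems for u m' h'
              apply (rule wp_Seq, rule wp_Assign[where x = "free + 3 * n"])
              apply (use b in \<open>simp_all\<close>)[4]
              apply (rule wp_Assign[where x = "card ?S"])
              apply (use b in \<open>simp_all\<close>)[4]
              subgoal
              proof -
                have "bij_betw (\<lambda>i. h' (free + 3 * n + i)) {..<card ?S} ?S \<longleftrightarrow>
                    bij_betw ((!) (leaves t)) {..<card ?S} ?S"
                  using prems length by (intro bij_betw_cong) auto
                moreover have "bij_betw ((!) (leaves t)) {..<card ?S} ?S"
                  using t(3,4) length by (intro bij_betw_nth) auto
                ultimately have "stores_set h' (free + 3 * n) (card ?S) ?S"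
                  by (simp add: stores_set_def)
                moreover have "depth u \<le> 100 * (d * path_bound + 1)"
                  using prems t(6) by (meson add_le_mono1 le_trans mult_le_mono2)
                moreover have "base u \<le> 200 * card ?S" "num_writes u = card ?S"
                    "written_cells u \<subseteq> {free..}"
                  using prems length by auto
                ultimately show ?thesis
                  using s r_cost by auto
              qed
              done
            done
        qed
        subgoal premises prems
        proof -
          have "?S = {}"
            using prems m56 finite_subset[OF sinks_subset] by auto
          then show ?thesis
            apply -
            apply (rule wp_Skip)
            apply (rule wp_Seq, rule wp_Assign[where x = "free + 3 * n"])
            apply (use b in \<open>simp_all\<close>)[4]
            apply (rule wp_Assign[where x = 0])
            apply (use b in \<open>simp_all\<close>)[4]
            subgoal using s r_cost by (auto simp: stores_set_def bij_betw_def)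
            done
        qed
        done
    qed
    done
qed

end

section \<open>Uniform constants\<close>

definition cost_factor :: "nat \<Rightarrow> nat \<Rightarrow> nat" where
  "cost_factor d k = 2000 + 2 * tracing.vertex_bound d k + 100 * d"

text \<open>Although defined in a locale that fixes the graph, \<open>vertex_bound\<close> depends
  on \<open>d\<close> and \<open>k\<close> only, which makes the constant uniform. It enters twice
  because the depth contains \<open>K * (D + 2)\<close>, at most \<open>2 * K * (D + 1)\<close>; the
  term \<open>100 * d\<close> pays for the height of the merge tree.\<close>

lemma program_bounds:
  fixes f :: "'x \<Rightarrow> nat \<Rightarrow> bool"
  assumes "rooted_dag {..<n} E r" "traceable {..<n} E r f x" "degree_le d {..<n} E"
    and "\<forall>v<n. f_cost x v \<le> k" "stores_graph h n E succs preds free"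
  shows "\<exists>t m' h'.
          run \<lparr>small_size = cost_factor d k * (longest_path {..<n} E + 1), word_bound = cost_factor d k * free,
               vis_pred = f x, pred_cost = f_cost x\<rparr>
              program [n, r, succs, preds, free] h t m' h' \<and>
          stores_set h' (m' 0) (m' 1) (output_set {..<n} E f x) \<and>
          written_cells t \<subseteq> {free..} \<and>
          (\<forall>\<omega>\<ge>1. work \<omega> t \<le> real (cost_factor d k) * \<omega> * (real (card (visible_set {..<n} f x)) + 1)) \<and>
          (\<forall>\<omega>\<ge>1. work \<omega> t \<le> real (cost_factor d k) * (real (card (visible_set {..<n} f x)) + 1
                                   + \<omega> * real (card (output_set {..<n} E f x)))) \<and>
          depth t \<le> cost_factor d k * (longest_path {..<n} E + 1) \<and>
          num_writes t \<le> cost_factor d k * card (output_set {..<n} E f x)"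
proof -
  define K where "K = tracing.vertex_bound d k"
  define c where "c = cost_factor d k"
  have c_eq: "c = 2000 + 2 * K + 100 * d"
    by (simp add: c_def cost_factor_def K_def)
  define D where "D = longest_path {..<n} E"
  define C where "C = \<lparr>small_size = c * (D + 1), word_bound = c * free,
    vis_pred = f x, pred_cost = f_cost x\<rparr>"
  have c: "20 \<le> c"
    by (simp add: c_eq)
  interpret tracing C n r succs preds free d k E h
  proof
    show "traceable {..<n} E r (\<lambda>_::unit. vis_pred C) ()"
      using assms(2) by (simp add: traceable_def C_def)
    show "20 \<le> small_size C" "20 * free \<le> word_bound C"
      using c by (simp_all add: C_def)
  qed (use assms in \<open>simp_all add: C_def\<close>)
  have V: "visible_set {..<n} f x = visible_vertices"
    by (auto simp: visible_set_def C_def)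
  have S: "output_set {..<n} E f x = sinks visible_vertices"
    using output_eq by (simp add: output_set_def C_def)
  define R where "R = card visible_vertices"
  define N where "N = card (sinks visible_vertices)"
  \<comment> \<open>For the first work bound the terms in the number of outputs are absorbed by the
    visible vertices.\<close>
  have N_le: "N \<le> R"
    unfolding N_def R_def by (intro card_mono sinks_subset) auto
  obtain t m' h' where exec: "exec C program main_proc (frame [n, r, succs, preds, free], h) t (m', h')"
    and out: "stores_set h' (m' 0) (m' 1) (sinks visible_vertices)" "written_cells t \<subseteq> {free..}"
    and base: "base t \<le> 1000 + K * (R + 1) + 200 * N"
    and depth: "depth t \<le> 1000 + K * (D + 2) + 100 * (d * (D + 1) + 1)"
    and writes: "num_writes t \<le> 4 * N"
    using wp_main unfolding wp_def K_def R_def N_def D_def by auto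
  have "\<forall>w\<in>set [n, r, succs, preds, free]. w < word_bound C"
    using words by simp
  then have run: "run C program [n, r, succs, preds, free] h t m' h'"
    using exec words by (simp add: run_def program_def)
  have depth_le: "depth t \<le> c * (D + 1)"
    using depth by (simp add: c_eq algebra_simps)
  have base_le: "real (base t) \<le> 1000 + real K * (real R + 1) + 200 * real N"
    using of_nat_mono[OF base, where 'a = real] by (simp add: algebra_simps)
  have writes_le: "real (num_writes t) \<le> 4 * real N"
    using of_nat_mono[OF writes, where 'a = real] by simp
  have work2: "work \<omega> t \<le> real c * (real R + 1 + \<omega> * real N)" if "1 \<le> \<omega>" for \<omega>
  proof -
    \<comment> \<open>The cost 200 per output outside the writes is moved into the \<omega> term,
      which with the 4 writes gives 204.\<close>
    have "real N \<le> \<omega> * real N"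
      using that by (simp add: mult_le_cancel_right1)
    moreover have "\<omega> * real (num_writes t) \<le> 4 * (\<omega> * real N)"
      using mult_left_mono[OF writes_le, of \<omega>] that by simp
    ultimately have "work \<omega> t \<le> (1000 + real K) * (real R + 1) + 204 * (\<omega> * real N)"
      using base_le unfolding work_eq distrib_left distrib_right by linarith
    also have "\<dots> \<le> real c * (real R + 1) + real c * (\<omega> * real N)"
      using that by (intro add_mono mult_right_mono) (auto simp: c_eq)
    finally show ?thesis
      by (simp add: algebra_simps)
  qed
  have work1: "work \<omega> t \<le> real c * \<omega> * (real R + 1)" if "1 \<le> \<omega>" for \<omega>
  proof -
    have "real (base t) \<le> (1200 + real K) * (real R + 1)"
      using base_le N_le by (simp add: algebra_simps)
    moreover have "1 * ((1200 + real K) * (real R + 1)) \<le> \<omega> * ((1200 + real K) * (real R + 1))"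
      using that by (intro mult_right_mono) auto
    moreover have "\<omega> * real (num_writes t) \<le> \<omega> * (4 * (real R + 1))"
      using writes_le N_le that by (intro mult_left_mono) auto
    ultimately have "work \<omega> t \<le> (1204 + real K) * (\<omega> * (real R + 1))"
      by (simp add: work_eq algebra_simps)
    also have "\<dots> \<le> real c * (\<omega> * (real R + 1))"
      using that by (intro mult_right_mono) (auto simp: c_eq)
    finally show ?thesis
      by (simp add: mult.assoc)
  qed
  have writes_c: "num_writes t \<le> c * N"
    using writes by (rule order_trans) (auto simp: c_eq)
  show ?thesis
    unfolding S V c_def[symmetric]
    using run out work1 work2 depth_le writes_c unfolding C_def D_def R_def N_def by blast
qed

theorem theorem1:
  "\<exists>P. \<forall>d k. \<exists>c::nat.
     \<forall>(f :: 'x \<Rightarrow> nat \<Rightarrow> bool) (x :: 'x) (f_cost :: 'x \<Rightarrow> nat \<Rightarrow> nat) n E r h succs preds free.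
       rooted_dag {..<n} E r \<longrightarrow>
       traceable {..<n} E r f x \<longrightarrow>
       degree_le d {..<n} E \<longrightarrow>
       (\<forall>v<n. f_cost x v \<le> k) \<longrightarrow>
       stores_graph h n E succs preds free \<longrightarrow>
       (\<exists>t m' h'.
          run \<lparr>small_size = c * (longest_path {..<n} E + 1), word_bound = c * free,
               vis_pred = f x, pred_cost = f_cost x\<rparr>
              P [n, r, succs, preds, free] h t m' h' \<and>
          stores_set h' (m' 0) (m' 1) (output_set {..<n} E f x) \<and>
          written_cells t \<subseteq> {free..} \<and>
          (\<forall>\<omega>\<ge>1. work \<omega> t \<le> real c * \<omega> * (real (card (visible_set {..<n} f x)) + 1)) \<and>
          (\<forall>\<omega>\<ge>1. work \<omega> t \<le> real c * (real (card (visible_set {..<n} f x)) + 1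
                                   + \<omega> * real (card (output_set {..<n} E f x)))) \<and>
          depth t \<le> c * (longest_path {..<n} E + 1) \<and>
          num_writes t \<le> c * card (output_set {..<n} E f x))"
  by (intro exI[of _ program] allI, rule exI, intro allI impI, rule program_bounds)

end
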